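(* Let $\alpha\in[0,1)$ be a discount factor and suppose that $D(\alpha)$, the set of optimal deterministic policies for the infinite-horizon problem with discount factor $\alpha$, is known. Consider the following algorithm, with input $\mathbb{X}$, $\{A(x)\}_{x\in\mathbb{X}}$, $\{r(x,a)\}_{x\in\mathbb{X},a\in A(x)}$, $\{p(y|x,a)\}_{x,y\in\mathbb{X},a\in A(x)}$, $D(\alpha)$. Line 1. Set $n=1$, $A_\alpha(x)=\{a\in A(x): a=\phi(x)\text{ for some }\phi\in D(\alpha)\}$ and $u(x,a)=r(x,a)$ for all $x\in\mathbb{X}$ and all $a\in A_\alpha(x)$. Line 2. While $n<m$ and $\{u(x,a)\}_{a\in A_\alpha(x)}$ is a singleton for every $x\in\mathbb{X}$, do: $n\leftarrow n+1$; $u(x)\leftarrow u(x,a)$ for any $a\in A_\alpha(x)$; then for all $x\in\mathbb{X}$ and $a\in A_\alpha(x)$, $u(x,a)\leftarrow\sum_{y\in\mathbb{X}}p(y|x,a)u(y)$. Line 3. If $n=m$, output "$\alpha$ is a regular point"; otherwise output "$\alpha$ is an irregular point". This algorithm takes at most $m$ iterations, and each iteration takes at most $O(mq)$ arithmetic operations. It verifies whether, for each $t=0,1,\ldots,m-1$, the vector $P^t(\phi)r(\phi)$ is the same for all $\phi\in D(\alpha)$; this property implies that $v_\beta^\phi=v_\beta^\psi$ for all $\beta\in[0,1)$ and all $\phi,\psi\in D(\alpha)$. Consequently, the algorithm also verifies whether $\alpha$ is an irregular point.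
   Context: A finite Markov decision process has a finite state set $\mathbb{X}=\{x^1,\ldots,x^m\}$ with $m$ states, a finite nonempty action set $A(x)$ for each $x\in\mathbb{X}$, real one-step rewards $r(x,a)$, and transition probabilities $p(\cdot|x,a)$ on $\mathbb{X}$; $q=\sum_{x\in\mathbb{X}}|A(x)|$ is the number of state-action pairs. $\mathbb{F}$ is the set of deterministic policies, i.e. maps $\phi$ on $\mathbb{X}$ with $\phi(x)\in A(x)$ for each $x$. $P(\phi)$ is the $m\times m$ stochastic matrix with entries $p(x^j|x^i,\phi(x^i))$, $P^t(\phi)$ is its $t$-th power (with $P^0(\phi)=I$), and $r(\phi)$ is the column vector with $r(\phi)(x)=r(x,\phi(x))$. For $\beta\in[0,1)$, $v_\beta^\phi=\sum_{t=0}^\infty\beta^tP^t(\phi)r(\phi)$ is the infinite-horizon expected total discounted reward vector of $\phi$, $V_\beta(x)=\max_{\phi\in\mathbb{F}}v_\beta^\phi(x)$, and $D(\beta)=\{\phi\in\mathbb{F}:v_\beta^\phi=V_\beta\}$. For $E\subset[0,1)$ let $D(E)=\bigcup_{\beta\in E}D(\beta)$. Let $D(0-)=\emptyset$, $D(\alpha-)=\bigcap_{i\ge1}D\big((\alpha-\frac1i,\alpha)\cap[0,1)\big)$ for $\alpha\in(0,1)$, and $D(\alpha+)=\bigcap_{i\ge1}D\big((\alpha,\alpha+\frac1i)\cap[0,1)\big)$ for $\alpha\in[0,1)$. A point $\alpha\in(0,1)$ is a break point if $D(\alpha-)\ne D(\alpha+)$; a point $\alpha\in[0,1)$ is a touching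 point if $D(\alpha)\ne D(\alpha-)\cup D(\alpha+)$. A point of $[0,1)$ is regular if it is neither a break point nor a touching point, and irregular otherwise.
   Formalization: At α=0 the printed test n<m can wrongly output "regular" (for m≥2), so correctness of the output "regular" is claimed for the printed loop only when α>0, and for all α∈[0,1) when the bound m in Lines 2 and 3 is replaced by m+1. *)

theory Defs
  imports Complex_Main "Jordan_Normal_Form.Matrix" "HOL-Library.While_Combinator" "HOL-Library.FuncSet"
begin

section \<open>Finite discounted Markov decision processes\<close>

text \<open>The states \<open>x\<^sup>1, \<dots>, x\<^sup>m\<close> are represented by the indices \<open>0, \<dots>, m - 1\<close>;
  \<open>tprob M x a y\<close> is \<open>p(y | x, a)\<close>.\<close>

record 'a mdp =
  nstates :: nat
  actions :: "nat \<Rightarrow> 'a set"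
  reward :: "nat \<Rightarrow> 'a \<Rightarrow> real"
  tprob :: "nat \<Rightarrow> 'a \<Rightarrow> nat \<Rightarrow> real"

definition finite_mdp :: "'a mdp \<Rightarrow> bool" where
  "finite_mdp M \<longleftrightarrow>
     1 \<le> nstates M \<and>
     (\<forall>x<nstates M. finite (actions M x) \<and> actions M x \<noteq> {}) \<and>
     (\<forall>x<nstates M. \<forall>a\<in>actions M x.
        (\<forall>y<nstates M. 0 \<le> tprob M x a y) \<and> (\<Sum>y<nstates M. tprob M x a y) = 1)"

definition num_pairs :: "'a mdp \<Rightarrow> nat" where
  "num_pairs M = (\<Sum>x<nstates M. card (actions M x))"

text \<open>Policies are extensional, so that two policies are equal iff they agree on all states.\<close>

definition policies :: "'a mdp \<Rightarrow> (nat \<Rightarrow> 'a) set" where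
  "policies M = (\<Pi>\<^sub>E x\<in>{..<nstates M}. actions M x)"

definition pol_mat :: "'a mdp \<Rightarrow> (nat \<Rightarrow> 'a) \<Rightarrow> real mat" where
  "pol_mat M \<phi> = mat (nstates M) (nstates M) (\<lambda>(i, j). tprob M i (\<phi> i) j)"

definition pol_reward :: "'a mdp \<Rightarrow> (nat \<Rightarrow> 'a) \<Rightarrow> real vec" where
  "pol_reward M \<phi> = vec (nstates M) (\<lambda>i. reward M i (\<phi> i))"

definition step_reward :: "'a mdp \<Rightarrow> nat \<Rightarrow> (nat \<Rightarrow> 'a) \<Rightarrow> real vec" where
  "step_reward M t \<phi> = (pol_mat M \<phi> ^\<^sub>m t) *\<^sub>v pol_reward M \<phi>"

definition pol_value :: "'a mdp \<Rightarrow> real \<Rightarrow> (nat \<Rightarrow> 'a) \<Rightarrow> real vec" where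
  "pol_value M \<beta> \<phi> = vec (nstates M) (\<lambda>i. \<Sum>t. \<beta> ^ t * (step_reward M t \<phi> $ i))"

definition opt_value :: "'a mdp \<Rightarrow> real \<Rightarrow> real vec" where
  "opt_value M \<beta> = vec (nstates M) (\<lambda>i. Max ((\<lambda>\<phi>. pol_value M \<beta> \<phi> $ i) ` policies M))"

definition opt_policies :: "'a mdp \<Rightarrow> real \<Rightarrow> (nat \<Rightarrow> 'a) set" where
  "opt_policies M \<beta> = {\<phi> \<in> policies M. pol_value M \<beta> \<phi> = opt_value M \<beta>}"

section \<open>Break points, touching points and regular points\<close>

definition opt_policies_on :: "'a mdp \<Rightarrow> real set \<Rightarrow> (nat \<Rightarrow> 'a) set" where
  "opt_policies_on M E = (\<Union>\<beta>\<in>E. opt_policies M \<beta>)"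

definition opt_left :: "'a mdp \<Rightarrow> real \<Rightarrow> (nat \<Rightarrow> 'a) set" where
  "opt_left M \<alpha> =
     (if \<alpha> = 0 then {}
      else (\<Inter>i\<in>{1::nat..}. opt_policies_on M ({\<alpha> - 1 / real i<..<\<alpha>} \<inter> {0..<1})))"

definition opt_right :: "'a mdp \<Rightarrow> real \<Rightarrow> (nat \<Rightarrow> 'a) set" where
  "opt_right M \<alpha> =
     (\<Inter>i\<in>{1::nat..}. opt_policies_on M ({\<alpha><..<\<alpha> + 1 / real i} \<inter> {0..<1}))"

definition break_point :: "'a mdp \<Rightarrow> real \<Rightarrow> bool" where
  "break_point M \<alpha> \<longleftrightarrow> \<alpha> \<in> {0<..<1} \<and> opt_left M \<alpha> \<noteq> opt_right M \<alpha>"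

definition touching_point :: "'a mdp \<Rightarrow> real \<Rightarrow> bool" where
  "touching_point M \<alpha> \<longleftrightarrow>
     \<alpha> \<in> {0..<1} \<and> opt_policies M \<alpha> \<noteq> opt_left M \<alpha> \<union> opt_right M \<alpha>"

definition regular_point :: "'a mdp \<Rightarrow> real \<Rightarrow> bool" where
  "regular_point M \<alpha> \<longleftrightarrow> \<alpha> \<in> {0..<1} \<and> \<not> break_point M \<alpha> \<and> \<not> touching_point M \<alpha>"

definition irregular_point :: "'a mdp \<Rightarrow> real \<Rightarrow> bool" where
  "irregular_point M \<alpha> \<longleftrightarrow> \<alpha> \<in> {0..<1} \<and> \<not> regular_point M \<alpha>"

definition same_step_rewards :: "'a mdp \<Rightarrow> real \<Rightarrow> bool" where
  "same_step_rewards M \<alpha> \<longleftrightarrow>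
     (\<forall>t<nstates M. \<forall>\<phi>\<in>opt_policies M \<alpha>. \<forall>\<psi>\<in>opt_policies M \<alpha>.
        step_reward M t \<phi> = step_reward M t \<psi>)"

section \<open>Programs that count their arithmetic operations\<close>

text \<open>The second component is the number of additions, multiplications and comparisons executed.
  Only the four primitive operations below increase it; copying a value is free.\<close>

type_synonym 'b counted = "'b \<times> nat"

definition ret :: "'b \<Rightarrow> 'b counted" where
  "ret x = (x, 0)"

definition bind_counted :: "'b counted \<Rightarrow> ('b \<Rightarrow> 'c counted) \<Rightarrow> 'c counted" (infixl ">>>=" 54) where
  "c >>>= f = (fst (f (fst c)), snd c + snd (f (fst c)))"

definition add_op :: "'b::plus \<Rightarrow> 'b \<Rightarrow> 'b counted" where
  "add_op x y = (x + y, 1)"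

definition mult_op :: "'b::times \<Rightarrow> 'b \<Rightarrow> 'b counted" where
  "mult_op x y = (x * y, 1)"

definition less_op :: "'b::ord \<Rightarrow> 'b \<Rightarrow> bool counted" where
  "less_op x y = (x < y, 1)"

definition eq_op :: "'b \<Rightarrow> 'b \<Rightarrow> bool counted" where
  "eq_op x y = (x = y, 1)"

fun for_each :: "'b list \<Rightarrow> ('b \<Rightarrow> 's \<Rightarrow> 's counted) \<Rightarrow> 's \<Rightarrow> 's counted" where
  "for_each [] f s = ret s"
| "for_each (b # bs) f s = (f b s >>>= for_each bs f)"

section \<open>The algorithm\<close>

text \<open>\<open>known_actions M D x\<close> is \<open>A\<^sub>\<alpha>(x)\<close> for \<open>D = D(\<alpha>)\<close>. The program runs through these sets in
  an arbitrary enumeration \<open>L\<close>; the choice of ``any \<open>a \<in> A\<^sub>\<alpha>(x)\<close>'' is the head of the enumeration.\<close>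

definition known_actions :: "'a mdp \<Rightarrow> (nat \<Rightarrow> 'a) set \<Rightarrow> nat \<Rightarrow> 'a set" where
  "known_actions M D x = {a \<in> actions M x. \<exists>\<phi>\<in>D. a = \<phi> x}"

definition enumerates_actions :: "'a mdp \<Rightarrow> (nat \<Rightarrow> 'a) set \<Rightarrow> (nat \<Rightarrow> 'a list) \<Rightarrow> bool" where
  "enumerates_actions M D L \<longleftrightarrow>
     (\<forall>x<nstates M. distinct (L x) \<and> set (L x) = known_actions M D x)"

definition singleton_test ::
  "'a mdp \<Rightarrow> (nat \<Rightarrow> 'a list) \<Rightarrow> (nat \<Rightarrow> 'a \<Rightarrow> real) \<Rightarrow> bool counted" where
  "singleton_test M L u =
     for_each [0..<nstates M]
       (\<lambda>x. for_each (tl (L x))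
          (\<lambda>a ok. eq_op (u x a) (u x (hd (L x))) >>>= (\<lambda>e. ret (ok \<and> e)))) True"

definition expected_next :: "'a mdp \<Rightarrow> (nat \<Rightarrow> real) \<Rightarrow> nat \<Rightarrow> 'a \<Rightarrow> real counted" where
  "expected_next M w x a =
     for_each [0..<nstates M] (\<lambda>y s. mult_op (tprob M x a y) (w y) >>>= (\<lambda>z. add_op s z)) 0"

definition update_all ::
  "'a mdp \<Rightarrow> (nat \<Rightarrow> 'a list) \<Rightarrow> (nat \<Rightarrow> real) \<Rightarrow> (nat \<Rightarrow> 'a \<Rightarrow> real) \<Rightarrow> (nat \<Rightarrow> 'a \<Rightarrow> real) counted"
  where
  "update_all M L w u =
     for_each [0..<nstates M]
       (\<lambda>x. for_each (L x)
          (\<lambda>a u. expected_next M w x a >>>= (\<lambda>s. ret (u(x := (u x)(a := s)))))) u"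

text \<open>The loop of the algorithm is ``while \<open>n < N\<close> and all \<open>{u(x,a)}\<close> are singletons'', where
  \<open>N = m\<close> is the published version. A loop state consists of \<open>n\<close>, \<open>u\<close> and a log with the number of
  arithmetic operations of each completed iteration (evaluation of the guard included).

  With \<open>N = m\<close> the vectors \<open>P\<^sup>t(\<phi>) r(\<phi>)\<close> are compared for \<open>t \<le> m - 2\<close> only. If \<open>\<alpha> > 0\<close>, equality for
  \<open>t = m - 1\<close> then follows, because \<open>P(\<phi>) V\<^sub>\<alpha> = (V\<^sub>\<alpha> - r(\<phi>)) / \<alpha>\<close> is the same for all \<open>\<phi> \<in> D(\<alpha>)\<close>; if
  \<open>\<alpha> = 0\<close> it does not, and the output can be wrong: let \<open>m = 2\<close>, let the rewards be \<open>0\<close> in the first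
  state and \<open>1\<close> in the second, which is absorbing, and let the first state have the two actions
  ``stay'' and ``move to the second state''. Both policies are optimal for \<open>\<alpha> = 0\<close>, only the second one
  for \<open>\<alpha> > 0\<close>, so \<open>0\<close> is a touching point, but the loop ends with \<open>n = m\<close>. The bound \<open>N = m + 1\<close> adds
  the missing comparison.\<close>

definition alg_guard ::
  "'a mdp \<Rightarrow> (nat \<Rightarrow> 'a list) \<Rightarrow> nat \<Rightarrow> nat \<Rightarrow> (nat \<Rightarrow> 'a \<Rightarrow> real) \<Rightarrow> bool counted" where
  "alg_guard M L N n u = (less_op n N >>>= (\<lambda>b. if b then singleton_test M L u else ret False))"

definition alg_body ::
  "'a mdp \<Rightarrow> (nat \<Rightarrow> 'a list) \<Rightarrow> nat \<Rightarrow> (nat \<Rightarrow> 'a \<Rightarrow> real) \<Rightarrow> (nat \<times> (nat \<Rightarrow> 'a \<Rightarrow> real)) counted"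
  where
  "alg_body M L n u =
     (add_op n 1 >>>= (\<lambda>n'. update_all M L (\<lambda>x. u x (hd (L x))) u >>>= (\<lambda>u'. ret (n', u'))))"

definition alg_run ::
  "'a mdp \<Rightarrow> (nat \<Rightarrow> 'a list) \<Rightarrow> nat \<Rightarrow> (nat \<times> (nat \<Rightarrow> 'a \<Rightarrow> real) \<times> nat list) option" where
  "alg_run M L N =
     while_option
       (\<lambda>(n, u, log). fst (alg_guard M L N n u))
       (\<lambda>(n, u, log). let ((n', u'), c) = alg_body M L n u
                       in (n', u', log @ [snd (alg_guard M L N n u) + c]))
       (1, reward M, [])"

datatype verdict = Regular | Irregular

definition verdict_of :: "nat \<Rightarrow> nat \<Rightarrow> verdict" where
  "verdict_of N n = (if n = N then Regular else Irregular)"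

text \<open>The programs compute the tests and updates of the informal description.\<close>

lemma fst_bind_counted [simp]: "fst (c >>>= f) = fst (f (fst c))"
  by (simp add: bind_counted_def)

lemma fst_for_each: "fst (for_each bs f s) = fold (\<lambda>b s. fst (f b s)) bs s"
  by (induction bs arbitrary: s) (simp_all add: ret_def)

lemma fst_expected_next:
  "fst (expected_next M w x a) = (\<Sum>y<nstates M. tprob M x a y * w y)"
proof -
  have "fold (\<lambda>y s. s + g y) [0..<k] c = c + (\<Sum>y<k. g y)" for k and g :: "nat \<Rightarrow> real" and c
    by (induction k) simp_all
  then show ?thesis
    by (simp add: expected_next_def fst_for_each mult_op_def add_op_def)
qed

lemma fst_singleton_test:
  assumes "\<forall>x<nstates M. L x \<noteq> []"
  shows "fst (singleton_test M L u) \<longleftrightarrow> (\<forall>x<nstates M. is_singleton (u x ` set (L x)))"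
proof -
  have fold_conj: "fold (\<lambda>b ok. ok \<and> Q b) bs c \<longleftrightarrow> c \<and> (\<forall>b\<in>set bs. Q b)"
    for bs :: "'b list" and Q c
    by (induction bs arbitrary: c) auto
  have row: "(\<forall>a\<in>set (tl xs). g a = g (hd xs)) \<longleftrightarrow> is_singleton (g ` set xs)"
    if "xs \<noteq> []" for xs :: "'a list" and g :: "'a \<Rightarrow> real"
    using that by (cases xs) (auto simp: is_singleton_def)
  have "fst (singleton_test M L u) \<longleftrightarrow>
      (\<forall>x<nstates M. \<forall>a\<in>set (tl (L x)). u x a = u x (hd (L x)))"
    by (auto simp: singleton_test_def fst_for_each eq_op_def ret_def fold_conj)
  then show ?thesis
    using assms row by blast
qed

lemma fst_update_all:
  assumes "x < nstates M" and "a \<in> set (L x)"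
  shows "fst (update_all M L w u) x a = (\<Sum>y<nstates M. tprob M x a y * w y)"
proof -
  define h where "h x = fold (\<lambda>a (u::nat \<Rightarrow> 'a \<Rightarrow> real).
      u(x := (u x)(a := \<Sum>y<nstates M. tprob M x a y * w y)))" for x
  have h: "h x as u x' a = (if x' = x \<and> a \<in> set as
      then \<Sum>y<nstates M. tprob M x a y * w y else u x' a)" for x as u x' a
    unfolding h_def by (induction as arbitrary: u) auto
  have "fold (\<lambda>x. h x (L x)) [0..<k] u x' a = (if x' < k \<and> a \<in> set (L x')
      then \<Sum>y<nstates M. tprob M x' a y * w y else u x' a)" for k x' a
    by (induction k) (auto simp: h less_Suc_eq)
  moreover have "fst (update_all M L w u) = fold (\<lambda>x. h x (L x)) [0..<nstates M] u"
    by (simp add: update_all_def fst_for_each fst_expected_next ret_def h_def)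
  ultimately show ?thesis
    using assms by simp
qed

end

theory Submission
  imports "HOL-Complex_Analysis.Conformal_Mappings" "Jordan_Normal_Form.Determinant" Defs
begin

text \<open>For stochastic matrices, \<open>P\<^bsup>t\<^esup> h\<close> is determined by the vectors with \<open>t < m\<close> through a linear recurrence,
  so agreement of the rewards \<open>P\<^bsup>t\<^esup>(\<phi>) r(\<phi>)\<close> for \<open>t < m\<close> is agreement for all \<open>t\<close>, and then all policies in
  \<open>D(\<alpha>)\<close> have the same value function on \<open>[0,1)\<close>. Some policy is optimal at discount factors
  converging to \<open>\<alpha>\<close> from a given side, and by continuity it lies in \<open>D(\<alpha>)\<close>; so in this case
  \<open>D(\<alpha>-) = D(\<alpha>) = D(\<alpha>+)\<close> and \<open>\<alpha>\<close> is regular. Conversely, at a regular point \<open>D(\<alpha>) = D(\<alpha>+)\<close>, and two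
  policies in \<open>D(\<alpha>+)\<close> have value functions that coincide at points accumulating at \<open>\<alpha>\<close>, hence by
  analyticity equal power series.\<close>

unbundle no vec_syntax

section \<open>Powers of stochastic matrices\<close>

text \<open>There are \<open>m + 1\<close> unknowns but only \<open>m\<close> equations. Padding the
  coefficient matrix with a zero row makes it square and singular, and a nonzero kernel vector
  supplies \<open>c\<close>.\<close>

lemma exists_nontrivial_relation:
  fixes f :: "nat \<Rightarrow> nat \<Rightarrow> 'a::field"
  obtains c where "\<exists>j\<le>m. c j \<noteq> 0" and "\<forall>x<m. (\<Sum>j\<le>m. c j * f j x) = 0"
proof -
  define r where "r x = vec (Suc m) (\<lambda>j. f j x)" for x
  define A where "A = mat\<^sub>r (Suc m) (Suc m) (\<lambda>x. if x = m then 0\<^sub>v (Suc m) else r x)"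
  have A: "A \<in> carrier_mat (Suc m) (Suc m)"
    by (simp add: A_def)
  have "det A = 0"
    unfolding A_def by (rule det_row_0) (auto simp: r_def)
  then obtain v where v: "v \<in> carrier_vec (Suc m)" "v \<noteq> 0\<^sub>v (Suc m)" "A *\<^sub>v v = 0\<^sub>v (Suc m)"
    using det_0_iff_vec_prod_zero_field[OF A] by blast
  show thesis
  proof
    show "\<exists>j\<le>m. v $ j \<noteq> 0"
    proof (rule ccontr)
      assume "\<not> (\<exists>j\<le>m. v $ j \<noteq> 0)"
      then have "v = 0\<^sub>v (Suc m)"
        using v(1) by (intro eq_vecI) (auto simp: less_Suc_eq_le)
      with v(2) show False by contradiction
    qed
    show "\<forall>x<m. (\<Sum>j\<le>m. v $ j * f j x) = 0"
    proof (intro allI impI)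
      fix x assume x: "x < m"
      have "(A *\<^sub>v v) $ x = (\<Sum>j<Suc m. f j x * v $ j)"
        using x v(1) by (simp add: A_def r_def scalar_prod_def lessThan_atLeast0)
      moreover have "(A *\<^sub>v v) $ x = 0"
        using v(3) x by simp
      ultimately show "(\<Sum>j\<le>m. v $ j * f j x) = 0"
        by (simp add: mult.commute lessThan_Suc_atMost)
    qed
  qed
qed

text \<open>A matrix acting on functions of the state index, so that matrix powers become iterates
  \<open>^^\<close>. Only values of \<open>h\<close> below \<open>m\<close> enter, hence equalities
  are stated for such indices.\<close>

definition kernel_op :: "nat \<Rightarrow> (nat \<Rightarrow> nat \<Rightarrow> real) \<Rightarrow> (nat \<Rightarrow> real) \<Rightarrow> nat \<Rightarrow> real" where
  "kernel_op m p h x = (\<Sum>y<m. p x y * h y)"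

lemma kernel_op_cong: "(\<And>y. y < m \<Longrightarrow> g y = h y) \<Longrightarrow> kernel_op m p g x = kernel_op m p h x"
  by (auto simp: kernel_op_def intro!: sum.cong)

lemma kernel_op_diff:
  "kernel_op m p (\<lambda>y. g y - b * h y) x = kernel_op m p g x - b * kernel_op m p h x"
  by (simp add: kernel_op_def sum_subtractf sum_distrib_left algebra_simps)

text \<open>Row sums equal to 1 make the operator fix constants, so it preserves affine and not only
  linear combinations.\<close>

lemma kernel_op_pow_affine:
  assumes "\<And>x. x < m \<Longrightarrow> (\<Sum>y<m. p x y) = 1"
    and "\<And>x. x < m \<Longrightarrow> g x = a + (\<Sum>i\<in>I. b i * f i x)" and "x < m"
  shows "(kernel_op m p ^^ s) g x = a + (\<Sum>i\<in>I. b i * (kernel_op m p ^^ s) (f i) x)"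
  using assms(3)
proof (induction s arbitrary: x)
  case 0
  then show ?case using assms(2) by simp
next
  case (Suc s)
  have "(kernel_op m p ^^ Suc s) g x
      = (\<Sum>y<m. p x y * (a + (\<Sum>i\<in>I. b i * (kernel_op m p ^^ s) (f i) y)))"
    unfolding funpow.simps o_def kernel_op_def[of m p "(kernel_op m p ^^ s) g"]
    using Suc.IH by (intro sum.cong) auto
  also have "\<dots> = (\<Sum>y<m. p x y) * a
      + (\<Sum>y<m. \<Sum>i\<in>I. b i * (p x y * (kernel_op m p ^^ s) (f i) y))"
    by (simp add: distrib_left sum.distrib sum_distrib_right sum_distrib_left mult.left_commute)
  also have "\<dots> = a + (\<Sum>i\<in>I. b i * (kernel_op m p ^^ Suc s) (f i) x)"
    using assms(1)[OF Suc.prems]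
    by (subst sum.swap) (simp add: kernel_op_def sum_distrib_left)
  finally show ?case .
qed

text \<open>The \<open>m + 1\<close> vectors \<open>1, h, P h, \<dots>, P\<^bsup>m - 1\<^esup> h\<close> are dependent, so some \<open>P\<^bsup>k\<^esup> h\<close> with \<open>k < m\<close> is
  an affine combination of the earlier ones. Applying powers of a stochastic matrix to this relation
  gives a recurrence for \<open>P\<^bsup>t\<^esup> h\<close> whose coefficients depend only on the first \<open>m\<close> vectors.\<close>

lemma kernel_op_pow_agree:
  assumes p: "\<And>x. x < m \<Longrightarrow> (\<Sum>y<m. p x y) = 1" and q: "\<And>x. x < m \<Longrightarrow> (\<Sum>y<m. q x y) = 1"
    and agree: "\<And>t x. t < m \<Longrightarrow> x < m \<Longrightarrow> (kernel_op m p ^^ t) h x = (kernel_op m q ^^ t) h x"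
    and x: "x < m"
  shows "(kernel_op m p ^^ t) h x = (kernel_op m q ^^ t) h x"
proof -
  \<comment> \<open>Index 0 is the constant vector 1, so the powers are shifted by one and only
    those with exponent below \<open>m\<close> occur.\<close>
  define f where "f j = (case j of 0 \<Rightarrow> \<lambda>_. 1 | Suc i \<Rightarrow> (kernel_op m p ^^ i) h)" for j
  obtain c where c: "\<exists>j\<le>m. c j \<noteq> 0" "\<forall>x<m. (\<Sum>j\<le>m. c j * f j x) = 0"
    by (rule exists_nontrivial_relation)
  \<comment> \<open>The last nonzero coefficient: the relation can be solved for its vector in terms
    of the earlier ones.\<close>
  define J where "J = Max {j. j \<le> m \<and> c j \<noteq> 0}"
  have "J \<in> {j. j \<le> m \<and> c j \<noteq> 0}"
    unfolding J_def by (rule Max_in) (use c(1) in auto)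
  then have J: "J \<le> m" "c J \<noteq> 0" by auto
  have J_max: "c j = 0" if "J < j" "j \<le> m" for j
  proof (rule ccontr)
    assume "c j \<noteq> 0"
    then have "j \<le> J" unfolding J_def by (intro Max_ge) (use that in auto)
    with that show False by simp
  qed
  have rel: "(\<Sum>j\<le>J. c j * f j y) = 0" if "y < m" for y
  proof -
    have "(\<Sum>j\<le>J. c j * f j y) = (\<Sum>j\<le>m. c j * f j y)"
      by (rule sum.mono_neutral_left) (use J J_max in auto)
    with c(2) that show ?thesis by simp
  qed
  \<comment> \<open>Otherwise the relation would read \<open>c 0 * 1 = 0\<close> with
    \<open>c 0\<close> nonzero.\<close>
  have "J \<noteq> 0"
    using rel[OF x] J(2) by (intro notI) (simp add: f_def)
  then obtain k where k: "J = Suc k" by (cases J) auto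
  define a where "a = - c 0 / c J"
  define b where "b i = - c (Suc i) / c J" for i
  have split: "(\<Sum>j\<le>J. g j) = g 0 + (\<Sum>i<k. g (Suc i)) + g (Suc k)" for g :: "nat \<Rightarrow> real"
    unfolding k by (induction k) simp_all
  have comb: "(kernel_op m p ^^ k) h y = a + (\<Sum>i<k. b i * (kernel_op m p ^^ i) h y)"
    if "y < m" for y
  proof -
    have "c 0 + (\<Sum>i<k. c (Suc i) * (kernel_op m p ^^ i) h y) + c J * (kernel_op m p ^^ k) h y = 0"
      using rel[OF that] unfolding split by (simp add: f_def k)
    moreover have "(\<Sum>i<k. b i * (kernel_op m p ^^ i) h y)
        = - (\<Sum>i<k. c (Suc i) * (kernel_op m p ^^ i) h y) / c J"
      by (simp add: b_def sum_divide_distrib sum_negf)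
    ultimately show ?thesis
      using J(2) by (simp add: a_def field_simps)
  qed
  \<comment> \<open>Since \<open>J = Suc k\<close> is at most \<open>m\<close>, all exponents here
    are below \<open>m\<close>, and \<open>agree\<close> carries the relation from \<open>p\<close>
    to \<open>q\<close>.\<close>
  have comb': "(kernel_op m q ^^ k) h y = a + (\<Sum>i<k. b i * (kernel_op m q ^^ i) h y)"
    if "y < m" for y
    using comb[OF that] J k agree that by simp
  have step: "(kernel_op m r ^^ (k + s)) h y = a + (\<Sum>i<k. b i * (kernel_op m r ^^ (i + s)) h y)"
    if "r = p \<or> r = q" "y < m" for r s y
  proof -
    have "(kernel_op m r ^^ s) ((kernel_op m r ^^ k) h) y
        = a + (\<Sum>i<k. b i * (kernel_op m r ^^ s) ((kernel_op m r ^^ i) h) y)"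
      by (rule kernel_op_pow_affine) (use that p q comb comb' in auto)
    then show ?thesis
      by (simp add: funpow_add add.commute[of _ s])
  qed
  show ?thesis
    using x
  proof (induction t arbitrary: x rule: less_induct)
    case (less t)
    show ?case
    proof (cases "t < k")
      case True
      then show ?thesis using agree less.prems J k by simp
    next
      case False
      then obtain s where s: "t = k + s" using le_Suc_ex not_less by blast
      \<comment> \<open>The exponents \<open>i + s\<close> with \<open>i < k\<close> are smaller
        than \<open>t\<close>, so strong induction applies to every term of the recurrence.\<close>
      show ?thesis
        unfolding s using step less by (auto simp: s intro!: sum.cong)
    qed
  qed
qed

section \<open>Power series with accumulating zeros\<close>

text \<open>Bounded coefficients give convergence in the complex unit disc. The real zeros
  accumulate inside it, so the identity theorem makes the sum vanish on the whole disc.\<close>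

lemma power_series_eq_0:
  fixes d :: "nat \<Rightarrow> real"
  assumes bound: "\<And>t. \<bar>d t\<bar> \<le> R" and \<alpha>: "\<bar>\<alpha>\<bar> < 1"
    and lim: "\<alpha> islimpt {x. \<bar>x\<bar> < 1 \<and> (\<Sum>t. d t * x ^ t) = 0}"
  shows "d t = 0"
proof -
  define F where "F z = (\<Sum>t. complex_of_real (d t) * z ^ t)" for z
  have sums: "(\<lambda>t. complex_of_real (d t) * z ^ t) sums F z" if "norm z < 1" for z
  proof -
    have "summable (\<lambda>t. complex_of_real (d t) * z ^ t)"
    proof (rule summable_comparison_test')
      show "summable (\<lambda>t. R * norm z ^ t)"
        using that by (intro summable_mult summable_geometric) simp
      show "norm (complex_of_real (d t) * z ^ t) \<le> R * norm z ^ t" for t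
        using bound[of t] by (simp add: norm_mult norm_power mult_right_mono)
    qed
    then show ?thesis by (simp add: F_def summable_sums)
  qed
  have hol: "F holomorphic_on ball 0 1"
    by (rule power_series_holomorphic[where a = "\<lambda>t. complex_of_real (d t)"]) (use sums in auto)
  define U where "U = complex_of_real ` {x. \<bar>x\<bar> < 1 \<and> (\<Sum>t. d t * x ^ t) = 0}"
  have F_U: "F z = 0" if z: "z \<in> U" for z
  proof -
    obtain x where x: "z = complex_of_real x" "\<bar>x\<bar> < 1" "(\<Sum>t. d t * x ^ t) = 0"
      using z unfolding U_def by blast
    have "(\<lambda>t. complex_of_real (d t * x ^ t)) sums F z"
      using sums[of z] x by simp
    then have "(\<lambda>t. d t * x ^ t) sums Re (F z)" "(\<lambda>t. 0 :: real) sums Im (F z)"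
      by (simp_all add: sums_complex_iff)
    with x(3) show ?thesis
      by (metis complex_eqI sums_unique sums_zero sums_unique2 zero_complex.simps)
  qed
  have lim': "complex_of_real \<alpha> islimpt U"
    unfolding islimpt_approachable
  proof (intro allI impI)
    fix e :: real assume "0 < e"
    then obtain x where "\<bar>x\<bar> < 1 \<and> (\<Sum>t. d t * x ^ t) = 0" "x \<noteq> \<alpha>" "dist x \<alpha> < e"
      using lim unfolding islimpt_approachable by blast
    then show "\<exists>z\<in>U. z \<noteq> complex_of_real \<alpha> \<and> dist z (complex_of_real \<alpha>) < e"
      unfolding U_def by (intro bexI[of _ "complex_of_real x"]) (auto simp: dist_of_real)
  qed
  have zero: "F z = 0" if "norm z < 1" for z
    by (rule analytic_continuation[OF hol, of U "complex_of_real \<alpha>"])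
      (use that \<alpha> lim' F_U in \<open>auto simp: U_def\<close>)
  \<comment> \<open>As a formal power series, \<open>G\<close> is determined by its evaluation near
    0; convergence at 1/2 ensures a positive radius.\<close>
  define G where "G = Abs_fps (\<lambda>t. complex_of_real (d t))"
  have "G = 0"
  proof (rule eval_fps_eqD)
    have "summable (\<lambda>t. complex_of_real (d t) * (1 / 2) ^ t)"
      using sums[of "1 / 2"] by (simp add: sums_iff)
    from conv_radius_geI[OF this] show "0 < fps_conv_radius G"
      by (auto simp: fps_conv_radius_def G_def intro: less_le_trans[rotated])
    show "\<forall>\<^sub>F z in nhds 0. eval_fps G z = eval_fps 0 z"
      using eventually_nhds_in_open[of "ball 0 1" "0 :: complex"]
      by (auto elim!: eventually_mono simp: eval_fps_def G_def zero F_def[symmetric])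
  qed simp
  then have "fps_nth G t = 0" by simp
  then show ?thesis by (simp add: G_def)
qed

section \<open>Value functions and optimal policies\<close>

locale finite_discounted_mdp =
  fixes M :: "'a mdp"
  assumes finite_mdp: "finite_mdp M"
begin

abbreviation m :: nat where "m \<equiv> nstates M"

abbreviation trans_op :: "(nat \<Rightarrow> 'a) \<Rightarrow> (nat \<Rightarrow> real) \<Rightarrow> nat \<Rightarrow> real" where
  "trans_op \<phi> \<equiv> kernel_op m (\<lambda>x. tprob M x (\<phi> x))"

text \<open>Entrywise counterpart of \<open>step_reward\<close>, as \<open>val\<close> is of
  \<open>pol_value\<close>; \<open>step_reward_index\<close> is the bridge to the matrix
  form.\<close>

definition stage :: "(nat \<Rightarrow> 'a) \<Rightarrow> nat \<Rightarrow> nat \<Rightarrow> real" where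
  "stage \<phi> t = (trans_op \<phi> ^^ t) (\<lambda>x. reward M x (\<phi> x))"

definition val :: "(nat \<Rightarrow> 'a) \<Rightarrow> real \<Rightarrow> nat \<Rightarrow> real" where
  "val \<phi> \<beta> x = (\<Sum>t. \<beta> ^ t * stage \<phi> t x)"

lemma stage_0 [simp]: "stage \<phi> 0 x = reward M x (\<phi> x)"
  by (simp add: stage_def)

lemma stage_Suc: "stage \<phi> (Suc t) x = trans_op \<phi> (stage \<phi> t) x"
  by (simp add: stage_def)

lemma nstates_pos: "1 \<le> m"
  using finite_mdp by (simp add: finite_mdp_def)

lemma policy_action: "\<phi> \<in> policies M \<Longrightarrow> x < m \<Longrightarrow> \<phi> x \<in> actions M x"
  by (auto simp: policies_def)

lemma tprob_nonneg: "\<phi> \<in> policies M \<Longrightarrow> x < m \<Longrightarrow> y < m \<Longrightarrow> 0 \<le> tprob M x (\<phi> x) y"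
  using finite_mdp policy_action by (auto simp: finite_mdp_def)

lemma tprob_sum: "\<phi> \<in> policies M \<Longrightarrow> x < m \<Longrightarrow> (\<Sum>y<m. tprob M x (\<phi> x) y) = 1"
  using finite_mdp policy_action by (auto simp: finite_mdp_def)

lemma finite_policies: "finite (policies M)"
  unfolding policies_def using finite_mdp by (intro finite_PiE) (auto simp: finite_mdp_def)

lemma policies_nonempty: "policies M \<noteq> {}"
  unfolding policies_def using finite_mdp by (auto simp: finite_mdp_def PiE_eq_empty_iff)

lemma dim_step_reward: "step_reward M t \<phi> \<in> carrier_vec m"
  by (simp add: step_reward_def pol_mat_def carrier_vecI)

lemma step_reward_index: "x < m \<Longrightarrow> step_reward M t \<phi> $ x = stage \<phi> t x"
proof (induction t arbitrary: x)
  case 0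
  then show ?case by (simp add: step_reward_def pol_reward_def pol_mat_def)
next
  case (Suc t)
  let ?P = "pol_mat M \<phi>"
  have P: "?P \<in> carrier_mat m m" by (simp add: pol_mat_def)
  have r: "pol_reward M \<phi> \<in> carrier_vec m" by (simp add: pol_reward_def)
  \<comment> \<open>Matrix powers grow by a factor on the right, whereas \<open>stage\<close>
    applies the operator on the outside, that is, on the left.\<close>
  have "?P ^\<^sub>m Suc t = ?P * ?P ^\<^sub>m t"
    using P by (induction t) (auto simp: assoc_mult_mat[of _ m m _ m _ m])
  then have "step_reward M (Suc t) \<phi> = ?P *\<^sub>v step_reward M t \<phi>"
    unfolding step_reward_def using P r by (simp add: assoc_mult_mat_vec[of _ m m _ m])
  then have "step_reward M (Suc t) \<phi> $ x
      = (\<Sum>y<m. tprob M x (\<phi> x) y * step_reward M t \<phi> $ y)"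
    using Suc.prems dim_step_reward[of t \<phi>] P
    by (simp add: scalar_prod_def pol_mat_def lessThan_atLeast0)
  also have "\<dots> = stage \<phi> (Suc t) x"
    using Suc.IH by (simp add: stage_Suc kernel_op_def)
  finally show ?case .
qed

lemma step_reward_eq_iff:
  "step_reward M t \<phi> = step_reward M t \<psi> \<longleftrightarrow> (\<forall>x<m. stage \<phi> t x = stage \<psi> t x)"
  using dim_step_reward[of t \<phi>] dim_step_reward[of t \<psi>]
  by (auto simp: vec_eq_iff step_reward_index)

lemma pol_value_eq_iff:
  "pol_value M \<beta> \<phi> = pol_value M \<beta> \<psi> \<longleftrightarrow> (\<forall>x<m. val \<phi> \<beta> x = val \<psi> \<beta> x)"
  by (auto simp: vec_eq_iff pol_value_def val_def step_reward_index)

text \<open>The maximum is over a finite nonempty set, so a member attains it iff it dominates all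
  others. Optimality thus means dominating every policy at all states simultaneously.\<close>

lemma opt_policies_iff:
  "\<phi> \<in> opt_policies M \<beta> \<longleftrightarrow>
    \<phi> \<in> policies M \<and> (\<forall>\<psi>\<in>policies M. \<forall>x<m. val \<psi> \<beta> x \<le> val \<phi> \<beta> x)"
proof -
  have "pol_value M \<beta> \<phi> = opt_value M \<beta> \<longleftrightarrow>
      (\<forall>x<m. val \<phi> \<beta> x = Max ((\<lambda>\<psi>. val \<psi> \<beta> x) ` policies M))"
    by (auto simp: vec_eq_iff pol_value_def opt_value_def val_def step_reward_index)
  moreover have "val \<phi> \<beta> x = Max ((\<lambda>\<psi>. val \<psi> \<beta> x) ` policies M) \<longleftrightarrow>
      (\<forall>\<psi>\<in>policies M. val \<psi> \<beta> x \<le> val \<phi> \<beta> x)" if "\<phi> \<in> policies M" for x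
    using that finite_policies policies_nonempty by (subst eq_Max_iff) auto
  ultimately show ?thesis by (auto simp: opt_policies_def)
qed

lemma opt_policies_subset: "opt_policies M \<beta> \<subseteq> policies M"
  by (auto simp: opt_policies_def)

section \<open>Averaging by stochastic rows, convergence and the fixed point equation\<close>

lemma trans_op_mono:
  assumes "\<phi> \<in> policies M" "x < m" "\<And>y. y < m \<Longrightarrow> g y \<le> h y"
  shows "trans_op \<phi> g x \<le> trans_op \<phi> h x"
  unfolding kernel_op_def
  by (intro sum_mono mult_left_mono) (use assms tprob_nonneg in auto)

lemma trans_op_const: "\<phi> \<in> policies M \<Longrightarrow> x < m \<Longrightarrow> trans_op \<phi> (\<lambda>_. c) x = c"
  by (simp add: kernel_op_def tprob_sum flip: sum_distrib_right)

text \<open>An average of numbers in [-R, R] stays in [-R, R]; the sum of all absolute rewards is a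
  convenient R that works for every state and \<open>t\<close>.\<close>

lemma stage_bounded:
  assumes "\<phi> \<in> policies M" "x < m"
  shows "\<bar>stage \<phi> t x\<bar> \<le> (\<Sum>y<m. \<bar>reward M y (\<phi> y)\<bar>)" (is "_ \<le> ?R")
  using assms(2)
proof (induction t arbitrary: x)
  case 0
  then show ?case by (auto intro!: member_le_sum[of x "{..<m}" "\<lambda>y. \<bar>reward M y (\<phi> y)\<bar>"])
next
  case (Suc t)
  have "trans_op \<phi> (stage \<phi> t) x \<le> trans_op \<phi> (\<lambda>_. ?R) x"
    using Suc.IH by (intro trans_op_mono assms(1) Suc.prems) (meson abs_le_D1)
  moreover have "trans_op \<phi> (\<lambda>_. - ?R) x \<le> trans_op \<phi> (stage \<phi> t) x"
    using Suc.IH by (intro trans_op_mono assms(1) Suc.prems) (metis abs_le_D2 minus_le_iff)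
  ultimately show ?case
    using assms(1) Suc.prems by (simp add: stage_Suc trans_op_const abs_le_iff)
qed

lemma summable_val:
  assumes "\<phi> \<in> policies M" "x < m" "\<bar>\<beta>\<bar> < 1"
  shows "summable (\<lambda>t. \<beta> ^ t * stage \<phi> t x)"
proof (rule summable_comparison_test')
  show "summable (\<lambda>t. \<bar>\<beta>\<bar> ^ t * (\<Sum>y<m. \<bar>reward M y (\<phi> y)\<bar>))"
    using assms(3) by (intro summable_mult2 summable_geometric) simp
  show "norm (\<beta> ^ t * stage \<phi> t x) \<le> \<bar>\<beta>\<bar> ^ t * (\<Sum>y<m. \<bar>reward M y (\<phi> y)\<bar>)" for t
    using stage_bounded[OF assms(1,2), of t]
    by (simp add: abs_mult power_abs mult_left_mono)
qed

text \<open>Split off the term \<open>t = 0\<close>; in the rest, the finite sum over successor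
  states is exchanged with the convergent series.\<close>

lemma val_fixed_point:
  assumes \<phi>: "\<phi> \<in> policies M" and x: "x < m" and \<beta>: "\<bar>\<beta>\<bar> < 1"
  shows "val \<phi> \<beta> x = reward M x (\<phi> x) + \<beta> * trans_op \<phi> (val \<phi> \<beta>) x"
proof -
  have "val \<phi> \<beta> x = reward M x (\<phi> x) + (\<Sum>t. \<beta> ^ Suc t * stage \<phi> (Suc t) x)"
    unfolding val_def using suminf_split_head[OF summable_val[OF assms]] by simp
  also have "(\<Sum>t. \<beta> ^ Suc t * stage \<phi> (Suc t) x)
      = (\<Sum>t. \<Sum>y<m. \<beta> * tprob M x (\<phi> x) y * (\<beta> ^ t * stage \<phi> t y))"
    by (simp add: stage_Suc kernel_op_def sum_distrib_left mult_ac)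
  also have "\<dots> = (\<Sum>y<m. \<Sum>t. \<beta> * tprob M x (\<phi> x) y * (\<beta> ^ t * stage \<phi> t y))"
    by (rule suminf_sum) (use summable_val[OF \<phi> _ \<beta>] in \<open>auto intro!: summable_mult\<close>)
  also have "\<dots> = (\<Sum>y<m. \<beta> * tprob M x (\<phi> x) y * val \<phi> \<beta> y)"
    unfolding val_def
    by (intro sum.cong refl suminf_mult) (use summable_val[OF \<phi> _ \<beta>] in auto)
  finally show ?thesis
    by (simp add: kernel_op_def sum_distrib_left mult_ac)
qed

text \<open>Look at a state where \<open>d\<close> is minimal.\<close>

lemma discounted_superharmonic_nonneg:
  assumes \<phi>: "\<phi> \<in> policies M" and \<beta>: "0 \<le> \<beta>" "\<beta> < 1"
    and d: "\<And>x. x < m \<Longrightarrow> \<beta> * trans_op \<phi> d x \<le> d x" and x: "x < m"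
  shows "0 \<le> d x"
proof -
  obtain z where z: "z < m" "\<And>y. y < m \<Longrightarrow> d z \<le> d y"
  proof -
    have "Min (d ` {..<m}) \<in> d ` {..<m}"
      using x by (intro Min_in) auto
    then obtain z where "z < m" "d z = Min (d ` {..<m})" by auto
    then show thesis by (intro that[of z]) auto
  qed
  have "d z \<le> trans_op \<phi> d z"
    using trans_op_mono[OF \<phi> z(1), of "\<lambda>_. d z" d] z trans_op_const[OF \<phi> z(1)] by auto
  then have "\<beta> * d z \<le> \<beta> * trans_op \<phi> d z"
    using \<beta>(1) by (rule mult_left_mono)
  also have "\<dots> \<le> d z" by (rule d[OF z(1)])
  finally have "0 \<le> (1 - \<beta>) * d z" by (simp add: algebra_simps)
  then have "0 \<le> d z" using \<beta>(2) by (simp add: zero_le_mult_iff)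
  with z(2)[OF x] show ?thesis by linarith
qed

text \<open>Subtracting the inequality for \<open>u\<close> from the fixed point equation makes
  \<open>val \<phi> \<beta> - u\<close> discounted superharmonic, hence nonnegative.\<close>

lemma subsolution_le_val:
  assumes \<phi>: "\<phi> \<in> policies M" and \<beta>: "0 \<le> \<beta>" "\<beta> < 1"
    and u: "\<And>x. x < m \<Longrightarrow> u x \<le> reward M x (\<phi> x) + \<beta> * trans_op \<phi> u x" and x: "x < m"
  shows "u x \<le> val \<phi> \<beta> x"
proof -
  \<comment> \<open>The factor 1 fits the pattern of \<open>kernel_op_diff\<close>.\<close>
  have "0 \<le> val \<phi> \<beta> x - 1 * u x"
  proof (rule discounted_superharmonic_nonneg[OF \<phi> \<beta> _ x])
    fix y assume y: "y < m"
    show "\<beta> * trans_op \<phi> (\<lambda>x. val \<phi> \<beta> x - 1 * u x) y \<le> val \<phi> \<beta> y - 1 * u y"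
      unfolding kernel_op_diff
      using u[OF y] val_fixed_point[OF \<phi> y, of \<beta>] \<beta> by (simp add: algebra_simps)
  qed
  then show ?thesis by simp
qed

text \<open>Mirror image of the previous argument. A function satisfying the optimality inequality
  for all actions therefore dominates the value of every policy.\<close>

lemma val_le_supersolution:
  assumes \<phi>: "\<phi> \<in> policies M" and \<beta>: "0 \<le> \<beta>" "\<beta> < 1"
    and u: "\<And>x. x < m \<Longrightarrow> reward M x (\<phi> x) + \<beta> * trans_op \<phi> u x \<le> u x" and x: "x < m"
  shows "val \<phi> \<beta> x \<le> u x"
proof -
  have "0 \<le> u x - 1 * val \<phi> \<beta> x"
  proof (rule discounted_superharmonic_nonneg[OF \<phi> \<beta> _ x])
    fix y assume y: "y < m"
    show "\<beta> * trans_op \<phi> (\<lambda>x. u x - 1 * val \<phi> \<beta> x) y \<le> u y - 1 * val \<phi> \<beta> y"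
      unfolding kernel_op_diff
      using u[OF y] val_fixed_point[OF \<phi> y, of \<beta>] \<beta> by (simp add: algebra_simps)
  qed
  then show ?thesis by simp
qed

text \<open>A policy with maximal total value satisfies the optimality equation: switching to a better
  action in a single state would not decrease any value and increase one of them.\<close>

lemma opt_policies_nonempty:
  assumes \<beta>: "0 \<le> \<beta>" "\<beta> < 1"
  shows "opt_policies M \<beta> \<noteq> {}"
proof -
  define S where "S \<phi> = (\<Sum>x<m. val \<phi> \<beta> x)" for \<phi>
  obtain \<phi> where \<phi>: "\<phi> \<in> policies M" and max: "\<And>\<psi>. \<psi> \<in> policies M \<Longrightarrow> S \<psi> \<le> S \<phi>"
  proof -
    have "Max (S ` policies M) \<in> S ` policies M"
      using finite_policies policies_nonempty by (intro Max_in) auto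
    then obtain \<phi> where "\<phi> \<in> policies M" "S \<phi> = Max (S ` policies M)" by auto
    with that[of \<phi>] finite_policies show thesis by (simp add: Max_ge)
  qed
  let ?v = "val \<phi> \<beta>"
  have v: "?v x = reward M x (\<phi> x) + \<beta> * trans_op \<phi> ?v x" if "x < m" for x
    using val_fixed_point[OF \<phi> that] \<beta> by simp
  have opt: "reward M x a + \<beta> * (\<Sum>y<m. tprob M x a y * ?v y) \<le> ?v x"
    if x: "x < m" and a: "a \<in> actions M x" for x a
  proof (rule ccontr)
    assume better: "\<not> ?thesis"
    define \<psi> where "\<psi> = \<phi>(x := a)"
    have \<psi>: "\<psi> \<in> policies M"
      using \<phi> x a by (auto simp: \<psi>_def policies_def PiE_def Pi_def extensional_def)
    \<comment> \<open>Away from \<open>x\<close> this is the fixed point equation of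
      \<open>\<phi>\<close>; at \<open>x\<close> the new action is strictly better. So
      \<open>?v\<close> is a subsolution for \<open>\<psi>\<close>.\<close>
    have "?v y \<le> reward M y (\<psi> y) + \<beta> * trans_op \<psi> ?v y" if "y < m" for y
      using better v[OF that] by (cases "y = x") (auto simp: \<psi>_def kernel_op_def)
    from subsolution_le_val[OF \<psi> \<beta> this] have le: "?v y \<le> val \<psi> \<beta> y" if "y < m" for y
      using that by blast
    have "?v x < reward M x (\<psi> x) + \<beta> * trans_op \<psi> ?v x"
      using better by (simp add: \<psi>_def kernel_op_def)
    also have "\<dots> \<le> reward M x (\<psi> x) + \<beta> * trans_op \<psi> (val \<psi> \<beta>) x"
      using trans_op_mono[OF \<psi> x le] \<beta>(1) by (simp add: mult_left_mono)
    also have "\<dots> = val \<psi> \<beta> x"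
      using val_fixed_point[OF \<psi> x, of \<beta>] \<beta> by simp
    finally have "S \<phi> < S \<psi>"
      unfolding S_def using le x by (intro sum_strict_mono_ex1) auto
    with max[OF \<psi>] show False by simp
  qed
  have "\<phi> \<in> opt_policies M \<beta>"
    unfolding opt_policies_iff
  proof (intro conjI ballI allI impI \<phi>)
    fix \<psi> x assume \<psi>: "\<psi> \<in> policies M" and x: "x < m"
    show "val \<psi> \<beta> x \<le> ?v x"
      by (rule val_le_supersolution[OF \<psi> \<beta> _ x])
        (use opt policy_action[OF \<psi>] in \<open>auto simp: kernel_op_def\<close>)
  qed
  then show ?thesis by blast
qed

section \<open>From finitely many agreeing stage rewards to all of them\<close>

lemma stages_agree:
  assumes \<phi>: "\<phi> \<in> policies M" and \<psi>: "\<psi> \<in> policies M"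
    and "\<And>t x. t < m \<Longrightarrow> x < m \<Longrightarrow> stage \<phi> t x = stage \<psi> t x" and "x < m"
  shows "stage \<phi> t x = stage \<psi> t x"
proof -
  \<comment> \<open>The recurrence lemma compares two operators on one start vector. Agreement at
    \<open>t = 0\<close>, available as \<open>m\<close> is positive, lets the rewards of
    \<open>\<phi>\<close> replace those of \<open>\<psi>\<close>.\<close>
  have eq: "stage \<psi> t x = (trans_op \<psi> ^^ t) (\<lambda>x. reward M x (\<phi> x)) x" if "x < m" for t x
    using that
  proof (induction t arbitrary: x)
    case 0
    then show ?case using assms(3)[of 0 x] nstates_pos by simp
  next
    case (Suc t)
    then show ?case by (simp add: stage_Suc cong: kernel_op_cong)
  qed
  have "(trans_op \<phi> ^^ t) (\<lambda>x. reward M x (\<phi> x)) x = (trans_op \<psi> ^^ t) (\<lambda>x. reward M x (\<phi> x)) x"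
  proof (rule kernel_op_pow_agree)
    fix t x assume "t < m" "x < m"
    then show "(trans_op \<phi> ^^ t) (\<lambda>x. reward M x (\<phi> x)) x
        = (trans_op \<psi> ^^ t) (\<lambda>x. reward M x (\<phi> x)) x"
      using assms(3) eq by (metis stage_def)
  qed (use tprob_sum[OF \<phi>] tprob_sum[OF \<psi>] \<open>x < m\<close> in auto)
  with eq[OF \<open>x < m\<close>] show ?thesis by (simp add: stage_def)
qed

text \<open>From \<open>r = V - \<alpha> P V\<close> we get \<open>P\<^bsup>t\<^esup> r = P\<^bsup>t\<^esup> V - \<alpha> P\<^bsup>t + 1\<^esup> V\<close>. As \<open>V\<close> is common to all optimal policies
  and \<open>\<alpha> > 0\<close>, agreement of the first \<open>m - 1\<close> vectors \<open>P\<^bsup>t\<^esup> r\<close> is agreement of the first \<open>m\<close> vectors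
  \<open>P\<^bsup>t\<^esup> V\<close>.\<close>

lemma opt_stages_agree:
  assumes \<phi>: "\<phi> \<in> opt_policies M \<alpha>" and \<psi>: "\<psi> \<in> opt_policies M \<alpha>" and \<alpha>: "0 < \<alpha>" "\<alpha> < 1"
    and agree: "\<And>t x. Suc t < m \<Longrightarrow> x < m \<Longrightarrow> stage \<phi> t x = stage \<psi> t x" and x: "x < m"
  shows "stage \<phi> t x = stage \<psi> t x"
proof -
  have pol: "\<phi> \<in> policies M" "\<psi> \<in> policies M"
    using \<phi> \<psi> opt_policies_subset by auto
  define V where "V = val \<phi> \<alpha>"
  have V: "val \<chi> \<alpha> y = V y" if "\<chi> \<in> {\<phi>, \<psi>}" "y < m" for \<chi> y
    using that \<phi> \<psi> unfolding V_def opt_policies_iff by (auto intro: antisym)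
  have st: "stage \<chi> t y = (trans_op \<chi> ^^ t) V y - \<alpha> * (trans_op \<chi> ^^ Suc t) V y"
    if \<chi>: "\<chi> \<in> {\<phi>, \<psi>}" and y: "y < m" for \<chi> t y
    using y
  proof (induction t arbitrary: y)
    case 0
    have "val \<chi> \<alpha> y = reward M y (\<chi> y) + \<alpha> * trans_op \<chi> (val \<chi> \<alpha>) y"
      using \<chi> pol \<alpha> 0 by (intro val_fixed_point) auto
    moreover have "trans_op \<chi> (val \<chi> \<alpha>) y = trans_op \<chi> V y"
      using V[OF \<chi>] by (rule kernel_op_cong)
    ultimately show ?case using V[OF \<chi> 0] by simp
  next
    case (Suc t)
    have "stage \<chi> (Suc t) y
        = trans_op \<chi> (\<lambda>y. (trans_op \<chi> ^^ t) V y - \<alpha> * (trans_op \<chi> ^^ Suc t) V y) y"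
      unfolding stage_Suc using Suc.IH by (rule kernel_op_cong)
    then show ?case by (simp add: kernel_op_diff)
  qed
  have first: "(trans_op \<phi> ^^ t) V y = (trans_op \<psi> ^^ t) V y" if "t < m" "y < m" for t y
    using that
  proof (induction t arbitrary: y)
    case (Suc t)
    have "stage \<phi> t y = stage \<psi> t y" "(trans_op \<phi> ^^ t) V y = (trans_op \<psi> ^^ t) V y"
      using agree Suc by simp_all
    then have "\<alpha> * (trans_op \<phi> ^^ Suc t) V y = \<alpha> * (trans_op \<psi> ^^ Suc t) V y"
      using st[of \<phi> y t] st[of \<psi> y t] Suc.prems by (simp del: funpow.simps)
    then show ?case using \<alpha> by (simp del: funpow.simps)
  qed simp
  \<comment> \<open>Here the recurrence lemma starts from the common value vector \<open>V\<close>,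
    not from the rewards.\<close>
  have "(trans_op \<phi> ^^ t) V y = (trans_op \<psi> ^^ t) V y" if "y < m" for t y
    by (rule kernel_op_pow_agree) (fact tprob_sum[OF pol(1)] tprob_sum[OF pol(2)] first that)+
  then show ?thesis using st x by (simp del: funpow.simps)
qed

lemma same_step_rewards_iff:
  "same_step_rewards M \<alpha> \<longleftrightarrow> (\<forall>t. \<forall>\<phi>\<in>opt_policies M \<alpha>. \<forall>\<psi>\<in>opt_policies M \<alpha>. \<forall>x<m.
     stage \<phi> t x = stage \<psi> t x)"
proof
  assume same: "same_step_rewards M \<alpha>"
  show "\<forall>t. \<forall>\<phi>\<in>opt_policies M \<alpha>. \<forall>\<psi>\<in>opt_policies M \<alpha>. \<forall>x<m. stage \<phi> t x = stage \<psi> t x"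
  proof (intro allI ballI impI)
    fix t \<phi> \<psi> x
    assume \<phi>: "\<phi> \<in> opt_policies M \<alpha>" and \<psi>: "\<psi> \<in> opt_policies M \<alpha>" and x: "x < m"
    show "stage \<phi> t x = stage \<psi> t x"
    proof (rule stages_agree)
      show "stage \<phi> t x = stage \<psi> t x" if "t < m" "x < m" for t x
        using same \<phi> \<psi> that unfolding same_step_rewards_def step_reward_eq_iff by blast
    qed (use \<phi> \<psi> x opt_policies_subset in auto)
  qed
next
  assume "\<forall>t. \<forall>\<phi>\<in>opt_policies M \<alpha>. \<forall>\<psi>\<in>opt_policies M \<alpha>. \<forall>x<m. stage \<phi> t x = stage \<psi> t x"
  then show "same_step_rewards M \<alpha>"
    unfolding same_step_rewards_def step_reward_eq_iff by blast
qed

lemma same_step_rewards_val: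
  assumes "same_step_rewards M \<alpha>" "\<phi> \<in> opt_policies M \<alpha>" "\<psi> \<in> opt_policies M \<alpha>" "x < m"
  shows "val \<phi> \<beta> x = val \<psi> \<beta> x"
proof -
  have "stage \<phi> t x = stage \<psi> t x" for t
    using assms unfolding same_step_rewards_iff by blast
  then show ?thesis by (simp add: val_def)
qed

section \<open>Regular points\<close>

lemma isCont_val:
  assumes "\<phi> \<in> policies M" "x < m" "\<bar>\<beta>\<bar> < 1"
  shows "isCont (\<lambda>\<beta>. val \<phi> \<beta> x) \<beta>"
proof -
  \<comment> \<open>Continuity of a power series at \<open>\<beta>\<close> is obtained from
    convergence at a point of larger modulus.\<close>
  obtain K where K: "\<bar>\<beta>\<bar> < K" "K < 1" using assms(3) dense by blast
  have "isCont (\<lambda>\<beta>. \<Sum>t. stage \<phi> t x * \<beta> ^ t) \<beta>"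
    by (rule isCont_powser[of _ K])
      (use summable_val[OF assms(1,2), of K] K in \<open>auto simp: mult.commute\<close>)
  then show ?thesis by (simp add: val_def mult.commute)
qed

text \<open>One notion for both one-sided limits: \<open>{0..<\<alpha>}\<close> as \<open>S\<close>
  yields D(\<alpha>-) and \<open>{\<alpha><..<1}\<close> yields D(\<alpha>+).\<close>

definition opt_near :: "real set \<Rightarrow> real \<Rightarrow> (nat \<Rightarrow> 'a) set" where
  "opt_near S \<alpha> = {\<phi>. \<forall>e>0. \<exists>\<beta>\<in>S. dist \<beta> \<alpha> < e \<and> \<phi> \<in> opt_policies M \<beta>}"

lemma opt_near_ex:
  "\<phi> \<in> opt_near S \<alpha> \<Longrightarrow> 0 < e \<Longrightarrow> \<exists>\<beta>\<in>S. dist \<beta> \<alpha> < e \<and> \<phi> \<in> opt_policies M \<beta>"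
  by (simp add: opt_near_def)

text \<open>The radii 1/i are cofinal among the positive reals, so the intersection over
  \<open>i\<close> is the condition for every \<open>e\<close>.\<close>

lemma INT_opt_policies_on_eq_opt_near:
  assumes "\<And>i. 1 \<le> i \<Longrightarrow> E i = {\<beta>\<in>S. dist \<beta> \<alpha> < 1 / real i}"
  shows "(\<Inter>i\<in>{1::nat..}. opt_policies_on M (E i)) = opt_near S \<alpha>"
proof (intro Set.set_eqI iffI)
  fix \<phi> assume \<phi>: "\<phi> \<in> (\<Inter>i\<in>{1::nat..}. opt_policies_on M (E i))"
  show "\<phi> \<in> opt_near S \<alpha>"
    unfolding opt_near_def
  proof (intro CollectI allI impI)
    fix e :: real assume "0 < e"
    then obtain n where n: "1 / real (Suc n) < e"
      by (metis reals_Archimedean inverse_eq_divide)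
    have "\<phi> \<in> opt_policies_on M (E (Suc n))" using \<phi> by simp
    then obtain \<beta> where "\<beta> \<in> E (Suc n)" "\<phi> \<in> opt_policies M \<beta>"
      by (auto simp: opt_policies_on_def)
    moreover from this have "\<beta> \<in> S" "dist \<beta> \<alpha> < 1 / real (Suc n)"
      using assms[of "Suc n"] by simp_all
    ultimately show "\<exists>\<beta>\<in>S. dist \<beta> \<alpha> < e \<and> \<phi> \<in> opt_policies M \<beta>"
      using n less_trans by blast
  qed
next
  fix \<phi> assume \<phi>: "\<phi> \<in> opt_near S \<alpha>"
  show "\<phi> \<in> (\<Inter>i\<in>{1::nat..}. opt_policies_on M (E i))"
  proof (intro INT_I)
    fix i :: nat assume i: "i \<in> {1..}"
    then obtain \<beta> where "\<beta> \<in> S" "dist \<beta> \<alpha> < 1 / real i" "\<phi> \<in> opt_policies M \<beta>"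
      using opt_near_ex[OF \<phi>, of "1 / real i"] by auto
    then show "\<phi> \<in> opt_policies_on M (E i)"
      using assms[of i] i by (auto simp: opt_policies_on_def)
  qed
qed

lemma opt_right_eq: "0 \<le> \<alpha> \<Longrightarrow> opt_right M \<alpha> = opt_near {\<alpha><..<1} \<alpha>"
  unfolding opt_right_def
  by (rule INT_opt_policies_on_eq_opt_near) (auto simp: dist_real_def)

lemma opt_left_eq:
  assumes "0 < \<alpha>" "\<alpha> < 1"
  shows "opt_left M \<alpha> = opt_near {0..<\<alpha>} \<alpha>"
proof -
  have "\<alpha> \<noteq> 0" using assms by simp
  then show ?thesis
    unfolding opt_left_def if_not_P[OF \<open>\<alpha> \<noteq> 0\<close>]
    by (intro INT_opt_policies_on_eq_opt_near) (use assms in \<open>auto simp: dist_real_def\<close>)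
qed

text \<open>A policy strictly better than \<open>\<phi>\<close> at \<open>\<alpha>\<close> in some
  state would by continuity stay better on a neighbourhood, which contains a point where
  \<open>\<phi>\<close> is optimal.\<close>

lemma opt_near_subset_opt_policies:
  assumes "S \<subseteq> {0..<1}" "\<bar>\<alpha>\<bar> < 1"
  shows "opt_near S \<alpha> \<subseteq> opt_policies M \<alpha>"
proof
  fix \<phi> assume \<phi>: "\<phi> \<in> opt_near S \<alpha>"
  have pol: "\<phi> \<in> policies M"
    using opt_near_ex[OF \<phi>, of 1] opt_policies_subset by auto
  show "\<phi> \<in> opt_policies M \<alpha>"
    unfolding opt_policies_iff
  proof (intro conjI pol ballI allI impI)
    fix \<psi> x assume \<psi>: "\<psi> \<in> policies M" and x: "x < m"
    define g where "g \<beta> = val \<phi> \<beta> x - val \<psi> \<beta> x" for \<beta>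
    have "isCont g \<alpha>"
      unfolding g_def by (intro continuous_diff isCont_val pol \<psi> x assms(2))
    show "val \<psi> \<alpha> x \<le> val \<phi> \<alpha> x"
    proof (rule ccontr)
      assume "\<not> ?thesis"
      then have "g \<alpha> < 0" by (simp add: g_def)
      with \<open>isCont g \<alpha>\<close> obtain e where e: "0 < e" "\<And>\<beta>. dist \<beta> \<alpha> < e \<Longrightarrow> dist (g \<beta>) (g \<alpha>) < - g \<alpha>"
        unfolding continuous_at_eps_delta by (metis neg_0_less_iff_less)
      obtain \<beta> where \<beta>: "dist \<beta> \<alpha> < e" "\<phi> \<in> opt_policies M \<beta>"
        using opt_near_ex[OF \<phi> e(1)] by blast
      have "0 \<le> g \<beta>"
        using \<beta>(2) \<psi> x by (simp add: opt_policies_iff g_def)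
      with e(2)[OF \<beta>(1)] show False by (simp add: dist_real_def)
    qed
  qed
qed

text \<open>Otherwise every policy has a radius within which it is never optimal on
  \<open>S\<close>. As there are finitely many policies, the least radius is positive, yet some
  policy is optimal at a point of \<open>S\<close> within it.\<close>

lemma opt_near_nonempty:
  assumes S: "S \<subseteq> {0..<1}" and lim: "\<alpha> islimpt S"
  shows "opt_near S \<alpha> \<noteq> {}"
proof
  assume empty: "opt_near S \<alpha> = {}"
  have "\<exists>e>0. \<forall>\<beta>\<in>S. dist \<beta> \<alpha> < e \<longrightarrow> \<phi> \<notin> opt_policies M \<beta>" for \<phi>
    using empty unfolding opt_near_def by blast
  then obtain e where e: "\<And>\<phi>. 0 < e \<phi>"
      "\<And>\<phi> \<beta>. \<beta> \<in> S \<Longrightarrow> dist \<beta> \<alpha> < e \<phi> \<Longrightarrow> \<phi> \<notin> opt_policies M \<beta>"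
    by metis
  define e0 where "e0 = Min (e ` policies M)"
  have "0 < e0"
    unfolding e0_def using finite_policies policies_nonempty e(1) by (subst Min_gr_iff) auto
  then obtain \<beta> where \<beta>: "\<beta> \<in> S" "dist \<beta> \<alpha> < e0"
    using lim unfolding islimpt_approachable by blast
  obtain \<phi> where \<phi>: "\<phi> \<in> opt_policies M \<beta>"
    using opt_policies_nonempty[of \<beta>] S \<beta>(1) by fastforce
  have "e0 \<le> e \<phi>"
    unfolding e0_def using \<phi> opt_policies_subset finite_policies by (intro Min_le) auto
  with e(2)[OF \<beta>(1), of \<phi>] \<beta>(2) \<phi> show False by auto
qed

text \<open>Some \<open>\<phi>\<close> belongs to \<open>opt_near S \<alpha>\<close> and hence to
  D(\<alpha>). All members of D(\<alpha>) share its value function, so they are optimal wherever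
  \<open>\<phi>\<close> is.\<close>

lemma opt_near_eq_opt_policies:
  assumes same: "same_step_rewards M \<alpha>" and S: "S \<subseteq> {0..<1}" and lim: "\<alpha> islimpt S"
    and \<alpha>: "\<bar>\<alpha>\<bar> < 1"
  shows "opt_near S \<alpha> = opt_policies M \<alpha>"
proof
  show sub: "opt_near S \<alpha> \<subseteq> opt_policies M \<alpha>"
    by (rule opt_near_subset_opt_policies[OF S \<alpha>])
  obtain \<phi> where \<phi>: "\<phi> \<in> opt_near S \<alpha>"
    using opt_near_nonempty[OF S lim] by blast
  show "opt_policies M \<alpha> \<subseteq> opt_near S \<alpha>"
  proof
    fix \<psi> assume \<psi>: "\<psi> \<in> opt_policies M \<alpha>"
    have "val \<phi> \<beta> x = val \<psi> \<beta> x" if "x < m" for \<beta> x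
      using same_step_rewards_val[OF same _ \<psi> that] \<phi> sub by blast
    then have "\<psi> \<in> opt_policies M \<beta>" if "\<phi> \<in> opt_policies M \<beta>" for \<beta>
      using that \<psi> by (auto simp: opt_policies_iff)
    with \<phi> show "\<psi> \<in> opt_near S \<alpha>" unfolding opt_near_def by blast
  qed
qed

text \<open>The difference of the two value functions is analytic, and both nonnegative and nonpositive values occur arbitrarily close to
  \<open>\<alpha>\<close> on the right, hence has zeros accumulating at \<open>\<alpha>\<close>.\<close>

lemma opt_right_stages_eq:
  assumes \<alpha>: "0 \<le> \<alpha>" "\<alpha> < 1" and \<phi>: "\<phi> \<in> opt_right M \<alpha>" and \<psi>: "\<psi> \<in> opt_right M \<alpha>" and x: "x < m"
  shows "stage \<phi> t x = stage \<psi> t x"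
proof -
  have near: "\<phi> \<in> opt_near {\<alpha><..<1} \<alpha>" "\<psi> \<in> opt_near {\<alpha><..<1} \<alpha>"
    using \<phi> \<psi> \<alpha> opt_right_eq by auto
  have pol: "\<phi> \<in> policies M" "\<psi> \<in> policies M"
    using near[THEN opt_near_ex, of 1] opt_policies_subset by auto
  define g where "g \<beta> = val \<phi> \<beta> x - val \<psi> \<beta> x" for \<beta>
  have cont: "isCont g \<beta>" if "\<bar>\<beta>\<bar> < 1" for \<beta>
    unfolding g_def by (intro continuous_diff isCont_val pol x that)
  have series: "(\<Sum>t. (stage \<phi> t x - stage \<psi> t x) * \<beta> ^ t) = g \<beta>" if "\<bar>\<beta>\<bar> < 1" for \<beta>
    unfolding g_def val_def
    by (subst suminf_diff) (use summable_val[OF _ x that] pol in \<open>auto simp: algebra_simps\<close>)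
  have "stage \<phi> t x - stage \<psi> t x = 0"
  proof (rule power_series_eq_0[where d = "\<lambda>t. stage \<phi> t x - stage \<psi> t x"])
    show "\<bar>stage \<phi> t x - stage \<psi> t x\<bar>
        \<le> (\<Sum>y<m. \<bar>reward M y (\<phi> y)\<bar>) + (\<Sum>y<m. \<bar>reward M y (\<psi> y)\<bar>)" for t
      using stage_bounded[OF pol(1) x, of t] stage_bounded[OF pol(2) x, of t] by linarith
    show "\<bar>\<alpha>\<bar> < 1" using \<alpha> by simp
    show "\<alpha> islimpt {\<beta>. \<bar>\<beta>\<bar> < 1 \<and> (\<Sum>t. (stage \<phi> t x - stage \<psi> t x) * \<beta> ^ t) = 0}"
      unfolding islimpt_approachable
    proof (intro allI impI)
      fix e :: real assume e: "0 < e"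
      obtain b where b: "\<alpha> < b" "b < 1" "dist b \<alpha> < e" "\<phi> \<in> opt_policies M b"
        using opt_near_ex[OF near(1) e] by auto
      obtain c where c: "\<alpha> < c" "c < 1" "dist c \<alpha> < e" "\<psi> \<in> opt_policies M c"
        using opt_near_ex[OF near(2) e] by auto
      have sign: "0 \<le> g b" "g c \<le> 0"
        using b(4) c(4) pol x by (simp_all add: opt_policies_iff g_def)
      \<comment> \<open>The difference \<open>g\<close> is nonnegative where \<open>\<phi>\<close>
        is optimal and nonpositive where \<open>\<psi>\<close> is; a zero between \<open>b\<close>
        and \<open>c\<close> stays to the right of \<open>\<alpha>\<close> and within distance
        \<open>e\<close>.\<close>
      obtain z where z: "min b c \<le> z" "z \<le> max b c" "g z = 0"
      proof (cases "b \<le> c")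
        case True
        with IVT2[of g c 0 b] sign cont b c \<alpha> that show thesis by force
      next
        case False
        with IVT[of g c 0 b] sign cont b c \<alpha> that show thesis by force
      qed
      have "\<alpha> < z" "z < 1" "dist z \<alpha> < e"
        using z(1,2) b c by (auto simp: dist_real_def min_def max_def split: if_splits)
      then show "\<exists>\<beta>\<in>{\<beta>. \<bar>\<beta>\<bar> < 1 \<and> (\<Sum>t. (stage \<phi> t x - stage \<psi> t x) * \<beta> ^ t) = 0}.
          \<beta> \<noteq> \<alpha> \<and> dist \<beta> \<alpha> < e"
        using z(3) \<alpha> series[of z] by (intro bexI[of _ z]) auto
    qed
  qed
  then show ?thesis by simp
qed

lemma regular_point_iff:
  assumes \<alpha>: "\<alpha> \<in> {0..<1}"
  shows "regular_point M \<alpha> \<longleftrightarrow> same_step_rewards M \<alpha>"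
proof
  assume reg: "regular_point M \<alpha>"
  have D: "opt_policies M \<alpha> = opt_right M \<alpha>"
  \<comment> \<open>At 0 the left set is empty by convention and no break point is possible; for
    positive \<open>\<alpha>\<close> the absence of a break point merges the left and right
    sets.\<close>
  proof (cases "\<alpha> = 0")
    case True
    then show ?thesis
      using reg by (simp add: regular_point_def touching_point_def opt_left_def)
  next
    case False
    then show ?thesis
      using reg \<alpha> by (auto simp: regular_point_def touching_point_def break_point_def)
  qed
  then show "same_step_rewards M \<alpha>"
    unfolding same_step_rewards_iff D using \<alpha> by (auto intro: opt_right_stages_eq)
next
  assume same: "same_step_rewards M \<alpha>"
  have right: "opt_right M \<alpha> = opt_policies M \<alpha>"
  proof -
    have lim: "\<alpha> islimpt {\<alpha><..<1}" using \<alpha> by (intro islimpt_greaterThanLessThan1) simp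
    have "opt_near {\<alpha><..<1} \<alpha> = opt_policies M \<alpha>"
      by (rule opt_near_eq_opt_policies[OF same _ lim]) (use \<alpha> in auto)
    then show ?thesis using \<alpha> by (simp add: opt_right_eq)
  qed
  have left: "opt_left M \<alpha> = opt_policies M \<alpha>" if "0 < \<alpha>"
  proof -
    have "\<alpha> islimpt {0<..<\<alpha>}" using that by (rule islimpt_greaterThanLessThan2)
    then have lim: "\<alpha> islimpt {0..<\<alpha>}" by (rule islimpt_subset) auto
    have "opt_near {0..<\<alpha>} \<alpha> = opt_policies M \<alpha>"
      by (rule opt_near_eq_opt_policies[OF same _ lim]) (use \<alpha> in auto)
    then show ?thesis using \<alpha> that by (simp add: opt_left_eq)
  qed
  show "regular_point M \<alpha>"
    using \<alpha> left right
    by (cases "\<alpha> = 0") (auto simp: regular_point_def touching_point_def break_point_def opt_left_def)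
qed

end

section \<open>Cost and correctness of the algorithm\<close>

lemma snd_bind_counted: "snd (c >>>= f) = snd c + snd (f (fst c))"
  by (simp add: bind_counted_def)

text \<open>The bound \<open>g\<close> depends on the item but not on the running state, so costs
  add up whatever the intermediate results are.\<close>

lemma snd_for_each_le:
  assumes "\<And>b s. b \<in> set bs \<Longrightarrow> snd (f b s) \<le> g b"
  shows "snd (for_each bs f s) \<le> (\<Sum>b\<leftarrow>bs. g b)"
  using assms
  by (induction bs arbitrary: s) (simp_all add: ret_def snd_bind_counted add_mono)

lemma is_singleton_image_iff: "is_singleton (f ` A) \<longleftrightarrow> A \<noteq> {} \<and> (\<forall>x\<in>A. \<forall>y\<in>A. f x = f y)"
proof
  assume "is_singleton (f ` A)"
  then obtain c where c: "f ` A = {c}" by (auto simp: is_singleton_def)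
  then have "f x = c" if "x \<in> A" for x
    using that imageI[of x A f] by simp
  with c show "A \<noteq> {} \<and> (\<forall>x\<in>A. \<forall>y\<in>A. f x = f y)" by auto
next
  assume A: "A \<noteq> {} \<and> (\<forall>x\<in>A. \<forall>y\<in>A. f x = f y)"
  then obtain a where a: "a \<in> A" by blast
  have "f ` A = (\<lambda>_. f a) ` A"
    using A a by (intro image_cong) blast+
  then have "f ` A = {f a}"
    using a by (simp add: image_constant)
  then show "is_singleton (f ` A)" by (simp add: is_singleton_def)
qed

context finite_discounted_mdp
begin

section \<open>Operation counts of guard and body\<close>

lemma length_enumeration_le:
  assumes "enumerates_actions M D L" "x < m"
  shows "length (L x) \<le> card (actions M x)"
proof -
  have "length (L x) = card (known_actions M D x)"
    using assms distinct_card[of "L x"] by (simp add: enumerates_actions_def)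
  also have "\<dots> \<le> card (actions M x)"
    using finite_mdp assms(2) by (intro card_mono) (auto simp: finite_mdp_def known_actions_def)
  finally show ?thesis .
qed

lemma sum_list_states: "(\<Sum>x\<leftarrow>[0..<m]. g x) = (\<Sum>x<m. g x)" for g :: "nat \<Rightarrow> nat"
  by (simp add: sum_list_sum_nth lessThan_atLeast0)

lemma singleton_test_cost:
  assumes "enumerates_actions M D L"
  shows "snd (singleton_test M L u) \<le> num_pairs M"
proof -
  let ?row = "\<lambda>x. for_each (tl (L x))
    (\<lambda>a ok. eq_op (u x a) (u x (hd (L x))) >>>= (\<lambda>e. ret (ok \<and> e)))"
  have "snd (?row x ok) \<le> card (actions M x)" if "x < m" for x ok
  proof -
    have "snd (?row x ok) \<le> (\<Sum>a\<leftarrow>tl (L x). 1)"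
      by (rule snd_for_each_le) (simp add: snd_bind_counted eq_op_def ret_def)
    also have "\<dots> \<le> length (L x)" by (simp add: sum_list_triv)
    finally show ?thesis using length_enumeration_le[OF assms that] by simp
  qed
  then have "snd (singleton_test M L u) \<le> (\<Sum>x\<leftarrow>[0..<m]. card (actions M x))"
    unfolding singleton_test_def by (intro snd_for_each_le) simp
  then show ?thesis by (simp only: sum_list_states num_pairs_def)
qed

text \<open>One multiplication and one addition for each successor state.\<close>

lemma expected_next_cost: "snd (expected_next M w x a) \<le> 2 * m"
proof -
  have "snd (expected_next M w x a) \<le> (\<Sum>y\<leftarrow>[0..<m]. 2)"
    unfolding expected_next_def
    by (rule snd_for_each_le) (simp add: snd_bind_counted mult_op_def add_op_def)
  then show ?thesis by (simp add: sum_list_triv)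
qed

lemma update_all_cost:
  assumes "enumerates_actions M D L"
  shows "snd (update_all M L w u) \<le> 2 * (m * num_pairs M)"
proof -
  let ?row = "\<lambda>x. for_each (L x)
    (\<lambda>a u. expected_next M w x a >>>= (\<lambda>s. ret (u(x := (u x)(a := s)))))"
  have "snd (?row x u) \<le> card (actions M x) * (2 * m)" if "x < m" for x u
  proof -
    have "snd (?row x u) \<le> (\<Sum>a\<leftarrow>L x. 2 * m)"
      by (rule snd_for_each_le) (simp add: snd_bind_counted ret_def expected_next_cost)
    also have "\<dots> = length (L x) * (2 * m)" by (simp add: sum_list_triv)
    also have "\<dots> \<le> card (actions M x) * (2 * m)"
      using length_enumeration_le[OF assms that] by (rule mult_le_mono1)
    finally show ?thesis .
  qed
  then have "snd (update_all M L w u) \<le> (\<Sum>x\<leftarrow>[0..<m]. card (actions M x) * (2 * m))"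
    unfolding update_all_def by (intro snd_for_each_le) simp
  also have "\<dots> = num_pairs M * (2 * m)"
    by (simp only: sum_list_states num_pairs_def sum_distrib_right)
  finally show ?thesis by (simp add: mult_ac)
qed

lemma num_pairs_pos: "1 \<le> num_pairs M"
proof -
  have "0 < card (actions M 0)"
    using finite_mdp by (auto simp: finite_mdp_def card_gt_0_iff)
  also have "\<dots> \<le> num_pairs M"
    unfolding num_pairs_def using nstates_pos by (intro member_le_sum) auto
  finally show ?thesis by simp
qed

text \<open>These absorb the lower-order terms 1 and q into a multiple of mq.\<close>

lemma pairs_bounds: "1 \<le> m * num_pairs M" "num_pairs M \<le> m * num_pairs M"
  using nstates_pos num_pairs_pos by (auto simp: Suc_le_eq)

lemma alg_guard_cost:
  assumes "enumerates_actions M D L"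
  shows "snd (alg_guard M L N n u) \<le> 2 * (m * num_pairs M)"
proof -
  \<comment> \<open>One comparison of \<open>n\<close> with \<open>N\<close>, then at most one
    equality test per state-action pair.\<close>
  have "snd (alg_guard M L N n u) \<le> 1 + num_pairs M"
    using singleton_test_cost[OF assms, of u]
    by (simp add: alg_guard_def snd_bind_counted less_op_def ret_def)
  also have "\<dots> \<le> 2 * (m * num_pairs M)"
    using pairs_bounds by linarith
  finally show ?thesis .
qed

lemma alg_body_cost:
  assumes "enumerates_actions M D L"
  shows "snd (alg_body M L n u) \<le> 3 * (m * num_pairs M)"
proof -
  have "snd (alg_body M L n u) \<le> 1 + 2 * (m * num_pairs M)"
    using update_all_cost[OF assms, of "\<lambda>x. u x (hd (L x))" u]
    by (simp add: alg_body_def snd_bind_counted add_op_def ret_def)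
  also have "\<dots> \<le> 3 * (m * num_pairs M)"
    using pairs_bounds by linarith
  finally show ?thesis .
qed

section \<open>Loop invariant and verdict\<close>

lemma set_enumeration:
  assumes "enumerates_actions M (opt_policies M \<alpha>) L" "x < m"
  shows "set (L x) = (\<lambda>\<phi>. \<phi> x) ` opt_policies M \<alpha>"
  using assms policy_action[OF _ assms(2)] opt_policies_subset[of \<alpha>]
  by (auto simp: enumerates_actions_def known_actions_def)

text \<open>The test reads only entries \<open>u x a\<close> whose action \<open>a\<close> is chosen
  by some optimal policy, so it suffices to know \<open>u\<close> there. Nonemptiness of D(\<alpha>)
  makes "singleton" the same as "all equal".\<close>

lemma fst_alg_guard:
  assumes L: "enumerates_actions M (opt_policies M \<alpha>) L" and \<alpha>: "\<alpha> \<in> {0..<1}"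
    and u: "\<And>\<phi> x. \<phi> \<in> opt_policies M \<alpha> \<Longrightarrow> x < m \<Longrightarrow> u x (\<phi> x) = stage \<phi> t x"
  shows "fst (alg_guard M L N n u) \<longleftrightarrow> n < N \<and>
    (\<forall>\<phi>\<in>opt_policies M \<alpha>. \<forall>\<psi>\<in>opt_policies M \<alpha>. \<forall>x<m. stage \<phi> t x = stage \<psi> t x)"
proof -
  let ?D = "opt_policies M \<alpha>"
  have D: "?D \<noteq> {}" using opt_policies_nonempty \<alpha> by simp
  have nonempty: "\<forall>x<m. L x \<noteq> []"
    using set_enumeration[OF L] D by fastforce
  have "u x ` set (L x) = (\<lambda>\<phi>. stage \<phi> t x) ` ?D" if "x < m" for x
    using set_enumeration[OF L that] u that by (auto simp: image_image)
  moreover have "is_singleton ((\<lambda>\<phi>. stage \<phi> t x) ` ?D) \<longleftrightarrow>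
      (\<forall>\<phi>\<in>?D. \<forall>\<psi>\<in>?D. stage \<phi> t x = stage \<psi> t x)" for x
    using D by (simp add: is_singleton_image_iff)
  ultimately have "fst (singleton_test M L u) \<longleftrightarrow>
      (\<forall>\<phi>\<in>?D. \<forall>\<psi>\<in>?D. \<forall>x<m. stage \<phi> t x = stage \<psi> t x)"
    unfolding fst_singleton_test[OF nonempty] by (metis (no_types, lifting))
  then show ?thesis by (simp add: alg_guard_def less_op_def ret_def)
qed

text \<open>The heads of the enumerations may come from different optimal policies at different
  states. Agreement at stage \<open>t\<close> makes each of them carry the stage reward of the given
  \<open>\<phi>\<close>.\<close>

lemma fst_alg_body:
  assumes L: "enumerates_actions M (opt_policies M \<alpha>) L"
    and u: "\<And>\<phi> x. \<phi> \<in> opt_policies M \<alpha> \<Longrightarrow> x < m \<Longrightarrow> u x (\<phi> x) = stage \<phi> t x"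
    and same: "\<And>\<phi> \<psi> x. \<phi> \<in> opt_policies M \<alpha> \<Longrightarrow> \<psi> \<in> opt_policies M \<alpha> \<Longrightarrow> x < m \<Longrightarrow>
      stage \<phi> t x = stage \<psi> t x"
  shows "fst (fst (alg_body M L n u)) = n + 1"
    and "\<phi> \<in> opt_policies M \<alpha> \<Longrightarrow> x < m \<Longrightarrow>
      snd (fst (alg_body M L n u)) x (\<phi> x) = stage \<phi> (Suc t) x"
proof -
  show "fst (fst (alg_body M L n u)) = n + 1"
    by (simp add: alg_body_def add_op_def ret_def)
  assume \<phi>: "\<phi> \<in> opt_policies M \<alpha>" and x: "x < m"
  have hd: "u y (hd (L y)) = stage \<phi> t y" if y: "y < m" for y
  proof -
    have "L y \<noteq> []" using set_enumeration[OF L y] \<phi> by fastforce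
    then have "hd (L y) \<in> (\<lambda>\<psi>. \<psi> y) ` opt_policies M \<alpha>"
      using set_enumeration[OF L y] hd_in_set by blast
    then obtain \<psi> where "\<psi> \<in> opt_policies M \<alpha>" "hd (L y) = \<psi> y" by blast
    then show ?thesis using u same \<phi> y by metis
  qed
  have "\<phi> x \<in> set (L x)" using set_enumeration[OF L x] \<phi> by blast
  then have "snd (fst (alg_body M L n u)) x (\<phi> x)
      = (\<Sum>y<m. tprob M x (\<phi> x) y * u y (hd (L y)))"
    by (simp add: alg_body_def add_op_def ret_def fst_update_all[OF x])
  then show "snd (fst (alg_body M L n u)) x (\<phi> x) = stage \<phi> (Suc t) x"
    by (simp add: hd stage_Suc kernel_op_def)
qed

lemma alg_run_correct:
  assumes L: "enumerates_actions M (opt_policies M \<alpha>) L" and \<alpha>: "\<alpha> \<in> {0..<1}"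
    and N: "1 \<le> N"
  obtains n u log where "alg_run M L N = Some (n, u, log)" and "length log < N"
    and "\<forall>c\<in>set log. c \<le> 5 * (m * num_pairs M)"
    and "n = N \<longleftrightarrow> (\<forall>t. Suc t < N \<longrightarrow> (\<forall>\<phi>\<in>opt_policies M \<alpha>. \<forall>\<psi>\<in>opt_policies M \<alpha>.
      \<forall>x<m. stage \<phi> t x = stage \<psi> t x))"
proof -
  let ?D = "opt_policies M \<alpha>"
  define same where "same t \<longleftrightarrow> (\<forall>\<phi>\<in>?D. \<forall>\<psi>\<in>?D. \<forall>x<m. stage \<phi> t x = stage \<psi> t x)" for t
  define b where "b = (\<lambda>(n, u, log :: nat list). fst (alg_guard M L N n u))"
  define c where "c = (\<lambda>(n, u, log). let ((n', u'), k) = alg_body M L n u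
    in (n', u', log @ [snd (alg_guard M L N n u) + k]))"
  \<comment> \<open>After \<open>t = n - 1\<close> iterations, \<open>u\<close> holds stage
    \<open>t\<close> on the optimal actions and all earlier stages have passed the test.\<close>
  define Inv where "Inv = (\<lambda>(n, u, log). \<exists>t. n = Suc t \<and> n \<le> N \<and> length log = t \<and>
    (\<forall>k\<in>set log. k \<le> 5 * (m * num_pairs M)) \<and>
    (\<forall>\<phi>\<in>?D. \<forall>x<m. u x (\<phi> x) = stage \<phi> t x) \<and> (\<forall>s<t. same s))"
  have step: "Inv (c s) \<and> N - fst (c s) < N - fst s" if inv: "Inv s" and guard: "b s" for s
  proof -
    obtain n u log where s: "s = (n, u, log)" by (cases s)
    obtain t where t: "n = Suc t" "length log = t" "\<forall>k\<in>set log. k \<le> 5 * (m * num_pairs M)"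
      and u: "\<And>\<phi> x. \<phi> \<in> ?D \<Longrightarrow> x < m \<Longrightarrow> u x (\<phi> x) = stage \<phi> t x" and before: "\<forall>s<t. same s"
      using inv unfolding s Inv_def by auto
    have "fst (alg_guard M L N n u) \<longleftrightarrow> n < N \<and> same t"
      unfolding same_def by (rule fst_alg_guard[OF L \<alpha>]) (rule u)
    then have n: "n < N" and now: "same t" using guard by (simp_all add: s b_def)
    from now have agree: "stage \<phi> t x = stage \<psi> t x" if "\<phi> \<in> ?D" "\<psi> \<in> ?D" "x < m" for \<phi> \<psi> x
      unfolding same_def using that by blast
    obtain n' u' k where body: "alg_body M L n u = ((n', u'), k)" by (metis surj_pair)
    have "fst (fst (alg_body M L n u)) = n + 1"
      by (rule fst_alg_body(1)[OF L]) (fact u agree)+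
    then have "c s = (Suc n, u', log @ [snd (alg_guard M L N n u) + k])"
      by (simp add: s c_def body)
    moreover have "u' x (\<phi> x) = stage \<phi> (Suc t) x" if "\<phi> \<in> ?D" "x < m" for \<phi> x
    proof -
      have "snd (fst (alg_body M L n u)) x (\<phi> x) = stage \<phi> (Suc t) x"
        by (rule fst_alg_body(2)[OF L _ _ that]) (fact u agree)+
      then show ?thesis by (simp add: body)
    qed
    \<comment> \<open>The constant 5 is 2 for the guard plus 3 for the body.\<close>
    moreover have "snd (alg_guard M L N n u) + k \<le> 5 * (m * num_pairs M)"
      using alg_guard_cost[OF L, of N n u] alg_body_cost[OF L, of n u] by (simp add: body)
    ultimately show ?thesis
      using t before now n by (auto simp: s Inv_def less_Suc_eq)
  qed
  have init: "Inv (1, reward M, [])"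
    using N by (simp add: Inv_def)
  obtain s where run: "while_option b c (1, reward M, []) = Some s"
    using measure_while_option_Some[where P = Inv and f = "\<lambda>s. N - fst s", OF step init] by blast
  obtain n u log where s: "s = (n, u, log)" by (cases s)
  have "Inv s"
    by (rule while_option_rule[where P = Inv, OF _ run init]) (use step in blast)
  then obtain t where t: "n = Suc t" "n \<le> N" "length log = t"
      "\<forall>k\<in>set log. k \<le> 5 * (m * num_pairs M)"
    and u: "\<And>\<phi> x. \<phi> \<in> ?D \<Longrightarrow> x < m \<Longrightarrow> u x (\<phi> x) = stage \<phi> t x" and before: "\<forall>s<t. same s"
    unfolding s Inv_def by auto
  have "fst (alg_guard M L N n u) \<longleftrightarrow> n < N \<and> same t"
    unfolding same_def by (rule fst_alg_guard[OF L \<alpha>]) (rule u)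
  \<comment> \<open>On exit with \<open>n < N\<close>, stage \<open>n - 1\<close> is the one that
    fails; exit with \<open>n = N\<close> leaves stage \<open>N - 1\<close> untested.\<close>
  then have stop: "n < N \<Longrightarrow> \<not> same t"
    using while_option_stop[OF run] by (simp add: s b_def)
  show thesis
  proof (rule that)
    show "alg_run M L N = Some (n, u, log)"
      using run unfolding alg_run_def b_def c_def s .
    show "length log < N" using t by simp
    show "\<forall>c\<in>set log. c \<le> 5 * (m * num_pairs M)" by (rule t(4))
    have "n = N \<longleftrightarrow> (\<forall>t. Suc t < N \<longrightarrow> same t)"
      using before stop t by (metis Suc_less_eq le_neq_implies_less)
    then show "n = N \<longleftrightarrow> (\<forall>t. Suc t < N \<longrightarrow> (\<forall>\<phi>\<in>?D. \<forall>\<psi>\<in>?D.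
        \<forall>x<m. stage \<phi> t x = stage \<psi> t x))"
      unfolding same_def .
  qed
qed

text \<open>For \<open>N = m + 1\<close> the loop tests all \<open>t < m\<close>. For
  \<open>N = m\<close> it omits \<open>t = m - 1\<close>, which \<open>opt_stages_agree\<close>
  recovers when \<open>\<alpha>\<close> is positive. Agreement always leads to \<open>n = N\<close>,
  so the verdict \<open>Irregular\<close> is reliable even at 0.\<close>

lemma alg_run_verdict:
  assumes L: "enumerates_actions M (opt_policies M \<alpha>) L" and \<alpha>: "\<alpha> \<in> {0..<1}"
    and N: "N \<in> {m, m + 1}"
  shows "\<exists>n u log. alg_run M L N = Some (n, u, log) \<and> length log \<le> m \<and>
    (\<forall>c\<in>set log. c \<le> 5 * (m * num_pairs M)) \<and>
    snd (alg_guard M L N n u) \<le> 5 * (m * num_pairs M) \<and>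
    (0 < \<alpha> \<or> N = m + 1 \<longrightarrow> (n = N \<longleftrightarrow> same_step_rewards M \<alpha>)) \<and>
    (same_step_rewards M \<alpha> \<longrightarrow> n = N)"
proof -
  let ?same = "\<lambda>t. \<forall>\<phi>\<in>opt_policies M \<alpha>. \<forall>\<psi>\<in>opt_policies M \<alpha>. \<forall>x<m. stage \<phi> t x = stage \<psi> t x"
  have "1 \<le> N" using N nstates_pos by auto
  obtain n u log where run: "alg_run M L N = Some (n, u, log)" and len: "length log < N"
    and log: "\<forall>c\<in>set log. c \<le> 5 * (m * num_pairs M)"
    and n: "n = N \<longleftrightarrow> (\<forall>t. Suc t < N \<longrightarrow> ?same t)"
    by (rule alg_run_correct[OF L \<alpha> \<open>1 \<le> N\<close>])
  have guard: "snd (alg_guard M L N n u) \<le> 5 * (m * num_pairs M)"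
    using alg_guard_cost[OF L, of N n u] by linarith
  have if_same: "same_step_rewards M \<alpha> \<longrightarrow> n = N"
    unfolding n same_step_rewards_iff by blast
  have only_if: "same_step_rewards M \<alpha>" if nN: "n = N" and pos: "0 < \<alpha> \<or> N = m + 1"
  proof (cases "N = m + 1")
    case True
    with nN n have "?same t" if "t < m" for t
      using that by (metis Suc_eq_plus1 Suc_less_eq)
    then show ?thesis
      unfolding same_step_rewards_def step_reward_eq_iff by blast
  next
    case False
    then have "N = m" "0 < \<alpha>" using N pos by auto
    with nN n have first: "?same t" if "Suc t < m" for t
      using that by blast
    show ?thesis
      unfolding same_step_rewards_iff
    proof (intro allI ballI impI)
      fix t \<phi> \<psi> x assume opt: "\<phi> \<in> opt_policies M \<alpha>" "\<psi> \<in> opt_policies M \<alpha>" and x: "x < m"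
      show "stage \<phi> t x = stage \<psi> t x"
        by (rule opt_stages_agree[OF opt \<open>0 < \<alpha>\<close> _ _ x]) (use \<alpha> first opt in \<open>simp, blast\<close>)
    qed
  qed
  have "length log \<le> m" using len N by auto
  with run log guard if_same only_if show ?thesis by blast
qed

end

theorem mainTheorem2:
  shows "\<exists>C::nat. \<forall>(M :: 'a mdp) (\<alpha> :: real) (L :: nat \<Rightarrow> 'a list).
    finite_mdp M \<longrightarrow> \<alpha> \<in> {0..<1} \<longrightarrow> enumerates_actions M (opt_policies M \<alpha>) L \<longrightarrow>
      (\<forall>N\<in>{nstates M, nstates M + 1}. \<exists>n u log.
         alg_run M L N = Some (n, u, log) \<and>
         length log \<le> nstates M \<and>
         (\<forall>c\<in>set log. c \<le> C * (nstates M * num_pairs M)) \<and>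
         snd (alg_guard M L N n u) \<le> C * (nstates M * num_pairs M) \<and>
         (0 < \<alpha> \<or> N = nstates M + 1 \<longrightarrow>
            (verdict_of N n = Regular \<longleftrightarrow> same_step_rewards M \<alpha>) \<and>
            (verdict_of N n = Regular \<longleftrightarrow> regular_point M \<alpha>) \<and>
            (verdict_of N n = Irregular \<longleftrightarrow> irregular_point M \<alpha>)) \<and>
         (verdict_of N n = Irregular \<longrightarrow> \<not> same_step_rewards M \<alpha> \<and> irregular_point M \<alpha>)) \<and>
      (same_step_rewards M \<alpha> \<longrightarrow>
         (\<forall>\<beta>\<in>{0..<1}. \<forall>\<phi>\<in>opt_policies M \<alpha>. \<forall>\<psi>\<in>opt_policies M \<alpha>.
            pol_value M \<beta> \<phi> = pol_value M \<beta> \<psi>))"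
proof (rule exI[of _ 5], intro allI impI conjI ballI)
  fix M :: "'a mdp" and \<alpha> :: real and L
  assume fin: "finite_mdp M" and \<alpha>: "\<alpha> \<in> {0..<1}"
    and L: "enumerates_actions M (opt_policies M \<alpha>) L"
  interpret finite_discounted_mdp M by standard (rule fin)
  fix N assume N: "N \<in> {nstates M, nstates M + 1}"
  have verdict: "verdict_of N n = Regular \<longleftrightarrow> n = N" "verdict_of N n = Irregular \<longleftrightarrow> n \<noteq> N" for n
    by (simp_all add: verdict_of_def)
  \<comment> \<open>All verdict claims reduce to whether \<open>n = N\<close> matches
    \<open>same_step_rewards\<close>.\<close>
  have reg: "regular_point M \<alpha> \<longleftrightarrow> same_step_rewards M \<alpha>"
      "irregular_point M \<alpha> \<longleftrightarrow> \<not> same_step_rewards M \<alpha>"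
    using regular_point_iff[OF \<alpha>] \<alpha> by (auto simp: irregular_point_def)
  show "\<exists>n u log.
         alg_run M L N = Some (n, u, log) \<and>
         length log \<le> nstates M \<and>
         (\<forall>c\<in>set log. c \<le> 5 * (nstates M * num_pairs M)) \<and>
         snd (alg_guard M L N n u) \<le> 5 * (nstates M * num_pairs M) \<and>
         (0 < \<alpha> \<or> N = nstates M + 1 \<longrightarrow>
            (verdict_of N n = Regular \<longleftrightarrow> same_step_rewards M \<alpha>) \<and>
            (verdict_of N n = Regular \<longleftrightarrow> regular_point M \<alpha>) \<and>
            (verdict_of N n = Irregular \<longleftrightarrow> irregular_point M \<alpha>)) \<and>
         (verdict_of N n = Irregular \<longrightarrow> \<not> same_step_rewards M \<alpha> \<and> irregular_point M \<alpha>)"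
    unfolding verdict reg using alg_run_verdict[OF L \<alpha> N] by blast
next
  fix M :: "'a mdp" and \<alpha> \<beta> :: real and L \<phi> \<psi>
  assume fin: "finite_mdp M" and same: "same_step_rewards M \<alpha>"
    and opt: "\<phi> \<in> opt_policies M \<alpha>" "\<psi> \<in> opt_policies M \<alpha>"
  interpret finite_discounted_mdp M by standard (rule fin)
  show "pol_value M \<beta> \<phi> = pol_value M \<beta> \<psi>"
    unfolding pol_value_eq_iff using same_step_rewards_val[OF same opt] by blast
qed

end
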